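(* Let $r$ be a positive integer. There are only finitely many (up to isomorphism) excluded minors of rank $r$ for the class of frame matroids.
   Context: All matroids are finite. A matroid $M$ is a frame matroid if there is a matroid $N$ with $E(M)\subseteq E(N)$ and $N|E(M)=M$ such that $N$ has a basis $B$ with every element of $N$ spanned by at most two elements of $B$ (i.e. in the closure of some subset of $B$ of size at most two). The class of frame matroids is minor-closed. An excluded minor for a minor-closed class is a matroid that is not in the class but all of whose proper minors are in the class. *)

theory Defs
  imports Main "HOL-Library.Infinite_Typeclass"
begin

section \<open>Finite matroids\<close>

record 'a matroid =
  ground :: "'a set"
  indep :: "'a set \<Rightarrow> bool"

locale matroid =
  fixes M :: "'a matroid"
  assumes finite_ground: "finite (ground M)"
    and indep_subset_ground: "indep M X \<Longrightarrow> X \<subseteq> ground M"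
    and indep_empty: "indep M {}"
    and indep_subset: "indep M X \<Longrightarrow> Y \<subseteq> X \<Longrightarrow> indep M Y"
    and augmentation: "indep M X \<Longrightarrow> indep M Y \<Longrightarrow> card X < card Y
      \<Longrightarrow> \<exists>y \<in> Y - X. indep M (insert y X)"

definition basis_in :: "'a matroid \<Rightarrow> 'a set \<Rightarrow> 'a set \<Rightarrow> bool" where
  "basis_in M X B \<longleftrightarrow> B \<subseteq> X \<and> indep M B \<and>
     (\<forall>B'. B \<subseteq> B' \<longrightarrow> B' \<subseteq> X \<longrightarrow> indep M B' \<longrightarrow> B' = B)"

definition basis :: "'a matroid \<Rightarrow> 'a set \<Rightarrow> bool" where
  "basis M B \<longleftrightarrow> basis_in M (ground M) B"

definition rank_of :: "'a matroid \<Rightarrow> 'a set \<Rightarrow> nat" where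
  "rank_of M X = Max {card I | I. I \<subseteq> X \<and> indep M I}"

definition rank :: "'a matroid \<Rightarrow> nat" where
  "rank M = rank_of M (ground M)"

definition closure :: "'a matroid \<Rightarrow> 'a set \<Rightarrow> 'a set" where
  "closure M X = {e \<in> ground M. rank_of M (insert e X) = rank_of M X}"

section \<open>Minors\<close>

definition restrict :: "'a matroid \<Rightarrow> 'a set \<Rightarrow> 'a matroid" where
  "restrict M X = \<lparr>ground = ground M \<inter> X, indep = (\<lambda>I. I \<subseteq> X \<and> indep M I)\<rparr>"

definition delete :: "'a matroid \<Rightarrow> 'a set \<Rightarrow> 'a matroid" where
  "delete M D = restrict M (ground M - D)"

definition contract :: "'a matroid \<Rightarrow> 'a set \<Rightarrow> 'a matroid" where
  "contract M C = \<lparr>ground = ground M - C,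
     indep = (\<lambda>I. I \<subseteq> ground M - C \<and> (\<exists>B. basis_in M C B \<and> indep M (I \<union> B)))\<rparr>"

definition minor :: "'a matroid \<Rightarrow> 'a matroid \<Rightarrow> bool" where
  "minor N M \<longleftrightarrow> (\<exists>C D. C \<subseteq> ground M \<and> D \<subseteq> ground M \<and> C \<inter> D = {} \<and>
     N = delete (contract M C) D)"

definition proper_minor :: "'a matroid \<Rightarrow> 'a matroid \<Rightarrow> bool" where
  "proper_minor N M \<longleftrightarrow> minor N M \<and> N \<noteq> M"

definition excluded_minor :: "'a matroid set \<Rightarrow> 'a matroid \<Rightarrow> bool" where
  "excluded_minor \<C> M \<longleftrightarrow> matroid M \<and> M \<notin> \<C> \<and> (\<forall>N. proper_minor N M \<longrightarrow> N \<in> \<C>)"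

section \<open>Isomorphism\<close>

definition isomorphic :: "'a matroid \<Rightarrow> 'b matroid \<Rightarrow> bool" where
  "isomorphic M N \<longleftrightarrow> (\<exists>f. bij_betw f (ground M) (ground N) \<and>
     (\<forall>X \<subseteq> ground M. indep M X \<longleftrightarrow> indep N (f ` X)))"

definition iso_rel :: "('a matroid \<times> 'a matroid) set" where
  "iso_rel = {(M, N). matroid M \<and> matroid N \<and> isomorphic M N}"

section \<open>Frame matroids\<close>

text \<open>
  The matroid \<open>N\<close> may need elements outside \<open>ground M\<close>. The sort constraint guarantees that
  the type always has room for them; over a finite type the definition would be too restrictive.
  Every finite matroid has an isomorphic copy over any infinite type.
\<close>

definition frame_matroid :: "'a::infinite matroid \<Rightarrow> bool" where
  "frame_matroid M \<longleftrightarrow> matroid M \<and>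
     (\<exists>N B. matroid N \<and> ground M \<subseteq> ground N \<and> restrict N (ground M) = M \<and> basis N B \<and>
        (\<forall>e \<in> ground N. \<exists>A \<subseteq> B. card A \<le> 2 \<and> e \<in> closure N A))"

section \<open>Well-definedness\<close>

context matroid
begin

lemma finite_indep: "indep M X \<Longrightarrow> finite X"
  using finite_subset[OF indep_subset_ground finite_ground] .

lemma card_basis_in_ge:
  assumes "basis_in M X B" "indep M I" "I \<subseteq> X"
  shows "card I \<le> card B"
proof (rule ccontr)
  assume "\<not> card I \<le> card B"
  moreover have B: "B \<subseteq> X" "indep M B"
    and max: "indep M B' \<Longrightarrow> B \<subseteq> B' \<Longrightarrow> B' \<subseteq> X \<Longrightarrow> B' = B" for B'
    using assms(1) by (auto simp: basis_in_def)
  ultimately obtain y where y: "y \<in> I - B" "indep M (insert y B)"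
    using augmentation[OF B(2) assms(2)] by auto
  have "insert y B = B"
    using y B assms(3) by (intro max) auto
  then show False
    using y(1) by auto
qed

lemma indep_extends_to_basis_in:
  assumes "indep M I" "I \<subseteq> X"
  obtains B where "basis_in M X B" "I \<subseteq> B"
proof -
  let ?S = "{B. I \<subseteq> B \<and> B \<subseteq> X \<and> indep M B}"
  have "finite ?S"
    by (rule finite_subset[of _ "Pow (ground M)"]) (use finite_ground indep_subset_ground in auto)
  moreover have "I \<in> ?S" using assms by auto
  ultimately obtain B where "B \<in> ?S" "\<forall>B' \<in> ?S. B \<subseteq> B' \<longrightarrow> B = B'"
    using finite_has_maximal[of ?S] by blast
  then show thesis
    by (intro that[of B]) (auto simp: basis_in_def)
qed

lemma rank_of_eq_card_basis_in:
  assumes "basis_in M X B"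
  shows "rank_of M X = card B"
  unfolding rank_of_def
proof (rule Max_eqI)
  have "{card I | I. I \<subseteq> X \<and> indep M I} \<subseteq> card ` Pow (ground M)"
    using indep_subset_ground by auto
  then show "finite {card I | I. I \<subseteq> X \<and> indep M I}"
    using finite_ground finite_subset by blast
  show "card B \<in> {card I | I. I \<subseteq> X \<and> indep M I}"
    using assms unfolding basis_in_def by auto
qed (use card_basis_in_ge[OF assms] in auto)

lemma matroid_restrict: "matroid (restrict M X)"
proof
  show "\<exists>y \<in> Y - I. indep (restrict M X) (insert y I)"
    if "indep (restrict M X) I" "indep (restrict M X) Y" "card I < card Y" for I Y
  proof -
    have "indep M I" "indep M Y" "card I < card Y"
      using that by (auto simp: restrict_def)
    then obtain y where "y \<in> Y - I" "indep M (insert y I)"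
      using augmentation[of I Y] by blast
    with that show ?thesis
      by (intro bexI[of _ y]) (auto simp: restrict_def)
  qed
qed (use finite_ground indep_subset_ground indep_empty indep_subset in
      \<open>auto simp: restrict_def\<close>)

lemma matroid_delete: "matroid (delete M D)"
  unfolding delete_def by (rule matroid_restrict)

lemma indep_contract_basis:
  assumes "basis_in M C B" "basis_in M C B'" "I \<inter> C = {}" "indep M (I \<union> B)"
  shows "indep M (I \<union> B')"
proof -
  have BC: "B \<subseteq> C" "B' \<subseteq> C" "indep M B" "indep M B'"
    using assms by (auto simp: basis_in_def)
  obtain J where J: "basis_in M (I \<union> B \<union> B') J" "B' \<subseteq> J"
    using indep_extends_to_basis_in[of B' "I \<union> B \<union> B'"] BC by blast
  have fin: "finite I" "finite B" "finite J"
    using finite_indep[OF assms(4)] finite_indep[of J] J(1) by (auto simp: basis_in_def)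
  have J_indep: "indep M J" and "J \<subseteq> I \<union> B \<union> B'"
    using J by (auto simp: basis_in_def)
  moreover have "J \<inter> C = B'"
  proof -
    have "indep M (J \<inter> C)" "B' \<subseteq> J \<inter> C"
      using indep_subset[OF J_indep] J(2) BC(2) by auto
    then show ?thesis
      using assms(2) by (simp add: basis_in_def)
  qed
  ultimately have J_sub: "J \<subseteq> I \<union> B'"
    using BC(1) by blast
  have "card (I \<union> B) \<le> card J"
    using card_basis_in_ge[OF J(1) assms(4)] by auto
  moreover have "card (I \<union> B) = card I + card B"
    using fin assms(3) BC by (intro card_Un_disjoint) auto
  moreover have "card B = card B'"
    using assms rank_of_eq_card_basis_in by metis
  moreover have "card (I \<union> B') \<le> card I + card B'"
    by (rule card_Un_le)
  ultimately have "card (I \<union> B') \<le> card J"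
    by linarith
  then have "J = I \<union> B'"
    using J_sub fin finite_indep[OF BC(4)] by (intro card_seteq) auto
  then show ?thesis
    using J_indep by simp
qed

lemma indep_contract:
  assumes "basis_in M C B"
  shows "indep (contract M C) I \<longleftrightarrow> I \<subseteq> ground M - C \<and> indep M (I \<union> B)"
proof
  assume "indep (contract M C) I"
  then obtain B' where "I \<subseteq> ground M - C" "basis_in M C B'" "indep M (I \<union> B')"
    by (auto simp: contract_def)
  moreover from this have "I \<inter> C = {}" by auto
  ultimately show "I \<subseteq> ground M - C \<and> indep M (I \<union> B)"
    using indep_contract_basis[OF _ assms] by simp
next
  assume "I \<subseteq> ground M - C \<and> indep M (I \<union> B)"
  then show "indep (contract M C) I"
    using assms by (auto simp: contract_def)
qed

lemma matroid_contract: "matroid (contract M C)"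
proof -
  obtain B where B: "basis_in M C B"
    using indep_extends_to_basis_in[of "{}" C] indep_empty by auto
  note ind = indep_contract[OF B]
  show ?thesis
  proof
    show "finite (ground (contract M C))"
      using finite_ground by (simp add: contract_def)
    show "I \<subseteq> ground (contract M C)" if "indep (contract M C) I" for I
      using that by (simp add: contract_def)
    show "indep (contract M C) {}"
      using B by (simp add: ind basis_in_def)
    show "indep (contract M C) J" if "indep (contract M C) I" "J \<subseteq> I" for I J
      using that indep_subset[of "I \<union> B" "J \<union> B"] by (auto simp: ind)
    show "\<exists>y \<in> Y - I. indep (contract M C) (insert y I)"
      if "indep (contract M C) I" "indep (contract M C) Y" "card I < card Y" for I Y
    proof -
      have *: "I \<inter> B = {}" "Y \<inter> B = {}" "indep M (I \<union> B)" "indep M (Y \<union> B)"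
        using that B by (auto simp: ind basis_in_def)
      then have "finite I" "finite Y" "finite B"
        using finite_indep[of "I \<union> B"] finite_indep[of "Y \<union> B"] by auto
      then have "card (I \<union> B) < card (Y \<union> B)"
        using * that by (simp add: card_Un_disjoint)
      then obtain y where "y \<in> (Y \<union> B) - (I \<union> B)" "indep M (insert y (I \<union> B))"
        using augmentation[OF *(3,4)] by blast
      then show ?thesis
        using that by (intro bexI[of _ y]) (auto simp: ind)
    qed
  qed
qed

end

lemma matroid_minor: "matroid M \<Longrightarrow> minor N M \<Longrightarrow> matroid N"
  unfolding minor_def using matroid.matroid_contract matroid.matroid_delete by blast

lemma isomorphic_refl: "isomorphic M M"
  unfolding isomorphic_def by (intro exI[of _ id]) auto

lemma isomorphic_sym:
  assumes "isomorphic M N"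
  shows "isomorphic N M"
proof -
  obtain f where f: "bij_betw f (ground M) (ground N)"
    and ind: "\<forall>X \<subseteq> ground M. indep M X \<longleftrightarrow> indep N (f ` X)"
    using assms unfolding isomorphic_def by blast
  let ?g = "inv_into (ground M) f"
  have "indep N Y \<longleftrightarrow> indep M (?g ` Y)" if "Y \<subseteq> ground N" for Y
  proof -
    have "f ` ?g ` Y = Y" "?g ` Y \<subseteq> ground M"
      using f that by (auto simp: bij_betw_def image_inv_into_cancel inv_into_into)
    then show ?thesis using ind by metis
  qed
  then show ?thesis
    unfolding isomorphic_def using bij_betw_inv_into[OF f] by blast
qed

lemma isomorphic_trans:
  assumes "isomorphic M N" "isomorphic N P"
  shows "isomorphic M P"
proof -
  obtain f g where f: "bij_betw f (ground M) (ground N)"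
    "\<forall>X \<subseteq> ground M. indep M X \<longleftrightarrow> indep N (f ` X)"
    and g: "bij_betw g (ground N) (ground P)"
    "\<forall>X \<subseteq> ground N. indep N X \<longleftrightarrow> indep P (g ` X)"
    using assms unfolding isomorphic_def by blast
  have "indep M X \<longleftrightarrow> indep P ((g \<circ> f) ` X)" if "X \<subseteq> ground M" for X
  proof -
    have "f ` X \<subseteq> ground N"
      using f(1) that by (auto simp: bij_betw_def)
    then show ?thesis
      using f(2) g(2) that by (simp add: image_comp)
  qed
  then show ?thesis
    unfolding isomorphic_def using bij_betw_trans[OF f(1) g(1)] by blast
qed

lemma equiv_iso_rel: "equiv {M. matroid M} iso_rel"
proof (rule equivI)
  show "trans iso_rel"
    unfolding iso_rel_def trans_def using isomorphic_trans by blast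
qed (auto simp: iso_rel_def refl_on_def sym_def isomorphic_refl isomorphic_sym)

end

theory Submission imports Defs begin

text \<open>
  Let \<open>M\<close> be an excluded minor of rank \<open>r\<close>. Each deletion \<open>M - f\<close> sits in a matroid with a basis \<open>B\<close>,
  \<open>|B| \<le> 2r\<close>, in which every element \<open>e\<close> has a least support \<open>\<sigma> f e \<subseteq> B\<close> of size at most two. Such
  an ambient matroid can be recovered from \<open>M - f\<close> and \<open>\<sigma> f\<close>: a set is independent if and only
  if its part outside \<open>B\<close> is independent and the set is independent in the bicircular matroid of the
  graph \<open>\<sigma> f\<close>. If \<open>M\<close> is large, a pigeonhole argument on the lines of \<open>M\<close> yields a map \<open>\<tau>\<close> which on
  every set of at most \<open>2r + 1\<close> elements agrees with some \<open>\<sigma> f\<close>, \<open>f\<close> outside that set. The matroid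
  axioms for the ambient matroid built from \<open>M\<close> and \<open>\<tau>\<close> only involve so few elements, so \<open>M\<close> itself
  is a frame matroid, a contradiction. Hence the size of \<open>M\<close> is bounded in terms of \<open>r\<close>.
\<close>

section \<open>Rank and closure\<close>

context matroid
begin

lemma basis_in_exists:
  obtains I where "basis_in M X I"
  using indep_extends_to_basis_in[of "{}" X] indep_empty by auto

lemma card_le_rank_of: "indep M I \<Longrightarrow> I \<subseteq> X \<Longrightarrow> card I \<le> rank_of M X"
  by (metis basis_in_exists card_basis_in_ge rank_of_eq_card_basis_in)

lemma rank_of_witness:
  obtains I where "I \<subseteq> X" "indep M I" "rank_of M X = card I"
  by (metis basis_in_exists rank_of_eq_card_basis_in basis_in_def)

lemma rank_of_le_card: "finite X \<Longrightarrow> rank_of M X \<le> card X"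
  by (metis rank_of_witness card_mono)

lemma rank_of_indep: "indep M I \<Longrightarrow> rank_of M I = card I"
  by (meson card_le_rank_of finite_indep le_antisym order_refl rank_of_le_card)

lemma indep_if_card_le_rank_of: "finite X \<Longrightarrow> card X \<le> rank_of M X \<Longrightarrow> indep M X"
  by (metis card_seteq rank_of_witness)

lemma rank_of_mono: "X \<subseteq> Y \<Longrightarrow> rank_of M X \<le> rank_of M Y"
  by (metis card_le_rank_of order_trans rank_of_witness)

text \<open>A basis \<open>I\<close> of \<open>X \<inter> Y\<close> extends to a basis
  \<open>J\<close> of \<open>X \<union> Y\<close>. By maximality \<open>J\<close> meets
  \<open>X \<inter> Y\<close> exactly in \<open>I\<close>, and counting \<open>J \<inter> X\<close>
  and \<open>J \<inter> Y\<close> gives the inequality.\<close>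

lemma rank_of_submodular: "rank_of M (X \<union> Y) + rank_of M (X \<inter> Y) \<le> rank_of M X + rank_of M Y"
proof -
  obtain I where I: "basis_in M (X \<inter> Y) I"
    by (rule basis_in_exists)
  then have "indep M I" "I \<subseteq> X \<union> Y"
    by (auto simp: basis_in_def)
  then obtain J where J: "basis_in M (X \<union> Y) J" "I \<subseteq> J"
    by (rule indep_extends_to_basis_in)
  then have "indep M J" "J \<subseteq> X \<union> Y"
    by (auto simp: basis_in_def)
  then have sub: "indep M (J \<inter> A)" for A
    by (meson indep_subset inf_le1)
  have "I \<subseteq> J \<inter> (X \<inter> Y)"
    using I J(2) by (auto simp: basis_in_def)
  then have "J \<inter> (X \<inter> Y) = I"
    using I sub[of "X \<inter> Y"] unfolding basis_in_def by (metis inf_le2)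
  then have "J \<inter> X \<inter> (J \<inter> Y) = I"
    by blast
  moreover have "J = J \<inter> X \<union> J \<inter> Y"
    using \<open>J \<subseteq> X \<union> Y\<close> by blast
  ultimately have "card J + card I = card (J \<inter> X) + card (J \<inter> Y)"
    using card_Un_Int[of "J \<inter> X" "J \<inter> Y"] finite_indep[OF \<open>indep M J\<close>] by simp
  then show ?thesis
    using card_le_rank_of[OF sub, of X X] card_le_rank_of[OF sub, of Y Y]
      rank_of_eq_card_basis_in[OF I] rank_of_eq_card_basis_in[OF J(1)] by auto
qed

lemma rank_of_insert_le: "rank_of M (insert u X) \<le> Suc (rank_of M X)"
  using rank_of_submodular[of X "{u}"] rank_of_le_card[of "{u}"] by simp

text \<open>Submodularity for \<open>insert e X\<close> and \<open>Y\<close>: the gain from adding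
  \<open>e\<close> cannot grow when the set does.\<close>

lemma in_closure_mono:
  assumes "e \<in> closure M X" "X \<subseteq> Y"
  shows "e \<in> closure M Y"
proof -
  have "insert e X \<union> Y = insert e Y"
    using assms(2) by blast
  then have "rank_of M (insert e Y) + rank_of M (insert e X \<inter> Y) \<le> rank_of M (insert e X) + rank_of M Y"
    using rank_of_submodular[of "insert e X" Y] by simp
  moreover have "rank_of M X \<le> rank_of M (insert e X \<inter> Y)"
    by (rule rank_of_mono) (use assms(2) in auto)
  moreover have "rank_of M Y \<le> rank_of M (insert e Y)"
    by (rule rank_of_mono) auto
  ultimately show ?thesis
    using assms(1) by (simp add: closure_def)
qed

lemma closure_subset_ground: "closure M X \<subseteq> ground M"
  by (auto simp: closure_def)

lemma subset_closure: "X \<subseteq> ground M \<Longrightarrow> X \<subseteq> closure M X"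
  by (auto simp: closure_def insert_absorb)

lemma rank_of_Un_closure:
  assumes "A \<subseteq> closure M X"
  shows "rank_of M (X \<union> A) = rank_of M X"
proof -
  have "finite A"
    using assms closure_subset_ground finite_ground by (meson finite_subset)
  then show ?thesis
    using assms
  proof (induction A)
    case (insert a A)
    then have "a \<in> closure M (X \<union> A)"
      by (auto intro: in_closure_mono)
    with insert show ?case
      by (simp add: closure_def)
  qed simp
qed

lemma in_closure_trans:
  assumes "e \<in> closure M X" "X \<subseteq> closure M Y"
  shows "e \<in> closure M Y"
proof -
  have "e \<in> closure M (Y \<union> X)"
    using assms(1) by (rule in_closure_mono) simp
  then have "rank_of M (insert e (Y \<union> X)) = rank_of M Y"
    using rank_of_Un_closure[OF assms(2)] by (simp add: closure_def)
  moreover have "rank_of M (insert e Y) \<le> rank_of M (insert e (Y \<union> X))"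
    "rank_of M Y \<le> rank_of M (insert e Y)"
    by (auto intro!: rank_of_mono)
  ultimately show ?thesis
    using assms(1) by (simp add: closure_def)
qed

text \<open>Adding \<open>e\<close> to \<open>A\<close> raises the rank, and adding \<open>u\<close>
  raises it by at most one, so \<open>insert e A\<close> already has the rank of
  \<open>insert u A\<close>.\<close>

lemma closure_exchange:
  assumes "e \<in> closure M (insert u A)" "e \<notin> closure M A" "u \<in> ground M"
  shows "u \<in> closure M (insert e A)"
proof -
  have "rank_of M A < rank_of M (insert e A)"
    using assms rank_of_mono[OF subset_insertI, of A e] by (auto simp: closure_def)
  then have "rank_of M (insert u A) \<le> rank_of M (insert e A)"
    using rank_of_insert_le[of u A] by simp
  moreover have "rank_of M (insert e A) \<le> rank_of M (insert u (insert e A))"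
    by (rule rank_of_mono) auto
  moreover have "rank_of M (insert u (insert e A)) = rank_of M (insert u A)"
    using assms(1) by (simp add: closure_def insert_commute)
  ultimately show ?thesis
    using assms(3) by (simp add: closure_def)
qed

lemma dependent_insert_if_in_closure:
  assumes "e \<in> closure M X" "e \<notin> X" "finite X"
  shows "\<not> indep M (insert e X)"
  using assms rank_of_indep[of "insert e X"] rank_of_le_card[of X] by (auto simp: closure_def)

lemma in_closure_if_dependent_insert:
  assumes "indep M X" "\<not> indep M (insert e X)" "e \<in> ground M"
  shows "e \<in> closure M X"
proof -
  obtain I where I: "basis_in M (insert e X) I" "X \<subseteq> I"
    using indep_extends_to_basis_in[of X "insert e X"] assms(1) by blast
  then have "I \<subseteq> insert e X" "indep M I"
    by (auto simp: basis_in_def)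
  moreover from this have "I \<noteq> insert e X"
    using assms(2) by blast
  ultimately have "I = X"
    using I(2) by blast
  then show ?thesis
    using I(1) assms rank_of_eq_card_basis_in rank_of_indep by (auto simp: closure_def)
qed

lemma circuit_exists:
  assumes "finite X" "\<not> indep M X"
  obtains C where "C \<subseteq> X" "\<not> indep M C" "\<And>D. D \<subset> C \<Longrightarrow> indep M D"
proof -
  have "\<exists>C. C \<subseteq> X \<and> \<not> indep M C \<and> (\<forall>D. D \<subset> C \<longrightarrow> indep M D)"
    using assms
  proof (induction X rule: finite_psubset_induct)
    case (psubset X)
    then show ?case
      by (metis order_refl psubset_imp_subset subset_trans)
  qed
  with that show thesis by blast
qed

section \<open>Supports with respect to an independent set\<close>

text \<open>All subsets of \<open>B\<close> are independent, so \<open>A\<close> and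
  \<open>A'\<close> satisfy submodularity with equality. Adding \<open>e\<close> to both leaves no
  slack, hence \<open>e\<close> cannot raise the rank of \<open>A \<inter> A'\<close>.\<close>

lemma in_closure_Int:
  assumes "indep M B" "A \<subseteq> B" "A' \<subseteq> B" "e \<in> closure M A" "e \<in> closure M A'"
  shows "e \<in> closure M (A \<inter> A')"
proof -
  have ind: "rank_of M X = card X" if "X \<subseteq> B" for X
    using that assms(1) indep_subset rank_of_indep by blast
  have fin: "finite A" "finite A'"
    using assms finite_indep finite_subset by blast+
  have "rank_of M (insert e A \<union> insert e A') + rank_of M (insert e A \<inter> insert e A')
      \<le> rank_of M (insert e A) + rank_of M (insert e A')"
    by (rule rank_of_submodular)
  moreover have "rank_of M (A \<union> A') \<le> rank_of M (insert e A \<union> insert e A')"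
    "rank_of M (A \<inter> A') \<le> rank_of M (insert e (A \<inter> A'))"
    by (auto intro!: rank_of_mono)
  moreover have "insert e A \<inter> insert e A' = insert e (A \<inter> A')"
    by blast
  moreover have "rank_of M (insert e A) = card A" "rank_of M (insert e A') = card A'"
    using assms ind by (auto simp: closure_def)
  moreover have "rank_of M (A \<union> A') = card (A \<union> A')" "rank_of M (A \<inter> A') = card (A \<inter> A')"
    using assms by (auto intro!: ind)
  moreover have "card A + card A' = card (A \<union> A') + card (A \<inter> A')"
    using fin by (rule card_Un_Int)
  ultimately show ?thesis
    using assms(4) by (auto simp: closure_def)
qed

text \<open>The subsets of \<open>B\<close> that span \<open>e\<close> are closed under
  intersection, so a minimal one is the least one.\<close>

lemma least_support_exists:
  assumes "indep M B" "e \<in> closure M B"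
  obtains S where "S \<subseteq> B" "e \<in> closure M S"
    "\<And>A. A \<subseteq> B \<Longrightarrow> e \<in> closure M A \<Longrightarrow> S \<subseteq> A"
proof -
  have fin: "finite (Pow B)"
    using assms(1) finite_indep by simp
  have "B \<in> {A. A \<subseteq> B \<and> e \<in> closure M A}"
    using assms by simp
  then obtain S where S: "S \<in> {A. A \<subseteq> B \<and> e \<in> closure M A}"
    "\<forall>A \<in> {A. A \<subseteq> B \<and> e \<in> closure M A}. A \<subseteq> S \<longrightarrow> S = A"
    using finite_has_minimal[of "{A. A \<subseteq> B \<and> e \<in> closure M A}"] fin
    by (metis (no_types, lifting) PowI empty_iff finite_subset mem_Collect_eq subsetI)
  show thesis
  proof (rule that)
    fix A assume "A \<subseteq> B" "e \<in> closure M A"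
    then have "S \<inter> A \<in> {A. A \<subseteq> B \<and> e \<in> closure M A}"
      using S(1) in_closure_Int[OF assms(1), of S A] by auto
    then show "S \<subseteq> A"
      using S(2) by blast
  qed (use S(1) in auto)
qed

text \<open>For \<open>n = 2\<close> this turns the frame condition into a graph:
  \<open>\<sigma> e\<close> is the set of ends of the edge \<open>e\<close>.\<close>

lemma least_supports_exist:
  assumes B: "indep M B" and span: "\<And>e. e \<in> ground M \<Longrightarrow> \<exists>A \<subseteq> B. card A \<le> n \<and> e \<in> closure M A"
  obtains \<sigma> where "\<And>e. e \<in> ground M \<Longrightarrow> \<sigma> e \<subseteq> B \<and> e \<in> closure M (\<sigma> e) \<and> card (\<sigma> e) \<le> n
      \<and> (\<forall>A \<subseteq> B. e \<in> closure M A \<longrightarrow> \<sigma> e \<subseteq> A)"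
proof -
  have "\<exists>S. S \<subseteq> B \<and> e \<in> closure M S \<and> card S \<le> n \<and> (\<forall>A \<subseteq> B. e \<in> closure M A \<longrightarrow> S \<subseteq> A)"
    if e: "e \<in> ground M" for e
  proof -
    obtain A where A: "A \<subseteq> B" "card A \<le> n" "e \<in> closure M A"
      using span[OF e] by blast
    then have "e \<in> closure M B"
      using in_closure_mono by blast
    then obtain S where S: "S \<subseteq> B" "e \<in> closure M S"
      "\<And>A. A \<subseteq> B \<Longrightarrow> e \<in> closure M A \<Longrightarrow> S \<subseteq> A"
      using least_support_exists[OF B] by blast
    moreover have "card S \<le> card A"
      using A S finite_indep[OF B] by (meson card_mono finite_subset)
    ultimately show ?thesis
      using A(2) by (intro exI[of _ S]) auto
  qed
  with that show thesis by metis
qed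

end

section \<open>Frame matroids and bicircular independence\<close>

text \<open>
  With \<open>\<sigma> e\<close> read as the set of ends of an edge \<open>e\<close>, this is independence in the bicircular
  matroid of the graph: every component has at most one cycle.
\<close>

definition bicircular :: "('a \<Rightarrow> 'b set) \<Rightarrow> 'a set \<Rightarrow> bool" where
  "bicircular \<sigma> Z \<longleftrightarrow> (\<forall>Y \<subseteq> Z. card Y \<le> card (\<Union> (\<sigma> ` Y)))"

lemma bicircular_subset: "bicircular \<sigma> Z \<Longrightarrow> Y \<subseteq> Z \<Longrightarrow> bicircular \<sigma> Y"
  unfolding bicircular_def by (meson subset_trans)

lemma bicircular_cong: "(\<And>x. x \<in> Z \<Longrightarrow> \<sigma> x = \<tau> x) \<Longrightarrow> bicircular \<sigma> Z \<longleftrightarrow> bicircular \<tau> Z"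
proof -
  assume "\<And>x. x \<in> Z \<Longrightarrow> \<sigma> x = \<tau> x"
  then have "\<sigma> ` Y = \<tau> ` Y" if "Y \<subseteq> Z" for Y
    using that by (intro image_cong) auto
  then show ?thesis
    by (simp add: bicircular_def)
qed

context matroid
begin

context
  fixes B \<sigma>
  assumes indep_B: "indep M B"
    and \<sigma>: "\<And>e. e \<in> ground M \<Longrightarrow> \<sigma> e \<subseteq> B \<and> e \<in> closure M (\<sigma> e) \<and> card (\<sigma> e) \<le> 2
      \<and> (\<forall>A \<subseteq> B. e \<in> closure M A \<longrightarrow> \<sigma> e \<subseteq> A)"
begin

text \<open>An independent set \<open>Y\<close> lies in the closure of the union of its supports,
  which is independent as a subset of \<open>B\<close>; comparing ranks compares
  cardinalities.\<close>

lemma bicircular_if_indep: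
  assumes "indep M Z"
  shows "bicircular \<sigma> Z"
  unfolding bicircular_def
proof (intro allI impI)
  fix Y assume "Y \<subseteq> Z"
  with assms have Y: "indep M Y"
    by (rule indep_subset)
  then have Yg: "Y \<subseteq> ground M"
    by (rule indep_subset_ground)
  let ?V = "\<Union> (\<sigma> ` Y)"
  have "?V \<subseteq> B"
    using \<sigma> Yg by blast
  then have "indep M ?V"
    using indep_B indep_subset by blast
  have "Y \<subseteq> closure M ?V"
    using \<sigma> Yg by (meson UN_upper in_closure_mono subset_iff)
  then have "rank_of M Y \<le> rank_of M ?V"
    using rank_of_Un_closure[of Y ?V] rank_of_mono[of Y "?V \<union> Y"] by simp
  then show "card Y \<le> card ?V"
    using rank_of_indep[OF Y] rank_of_indep[OF \<open>indep M ?V\<close>] by simp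
qed

lemma support_basis_element:
  assumes "b \<in> B"
  shows "\<sigma> b = {b}"
proof -
  have bg: "b \<in> ground M"
    using assms indep_B indep_subset_ground by blast
  have "b \<in> closure M {b}"
    using subset_closure[of "{b}"] bg by simp
  then have "\<sigma> b \<subseteq> {b}"
    using \<sigma>[OF bg] assms by blast
  moreover have "\<sigma> b \<noteq> {}"
  proof
    assume "\<sigma> b = {}"
    then have "b \<in> closure M {}"
      using \<sigma>[OF bg] by simp
    then show False
      using dependent_insert_if_in_closure[of b "{}"] indep_subset[OF indep_B, of "{b}"] assms by simp
  qed
  ultimately show ?thesis by blast
qed

text \<open>An edge together with one end spans the other end: by leastness of the support,
  \<open>t\<close> alone does not span \<open>e\<close>, so exchange applies.\<close>

lemma support_other_end:
  assumes "e \<in> ground M" "t \<in> \<sigma> e" "u \<in> \<sigma> e"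
  shows "u \<in> closure M {e, t}"
proof (cases "u = t")
  case True
  then show ?thesis
    using assms \<sigma>[OF assms(1)] subset_closure[of "{e, t}"] indep_subset_ground[OF indep_B] by blast
next
  case False
  have "finite (\<sigma> e)"
    using \<sigma>[OF assms(1)] finite_indep[OF indep_B] finite_subset by blast
  moreover have "card {t, u} = 2" "{t, u} \<subseteq> \<sigma> e"
    using False assms by auto
  moreover have "card (\<sigma> e) \<le> card {t, u}"
    using \<open>card {t, u} = 2\<close> \<sigma>[OF assms(1)] by simp
  ultimately have "{t, u} = \<sigma> e"
    by (intro card_seteq)
  then have eq: "\<sigma> e = insert u {t}"
    by blast
  show ?thesis
  proof (rule closure_exchange)
    show "e \<in> closure M (insert u {t})"
      using \<sigma>[OF assms(1)] eq by simp
    have "{t} \<subseteq> B" "\<not> \<sigma> e \<subseteq> {t}"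
      using \<sigma>[OF assms(1)] eq False by auto
    then show "e \<notin> closure M {t}"
      using \<sigma>[OF assms(1)] by blast
    show "u \<in> ground M"
      using \<sigma>[OF assms(1)] assms(3) indep_subset_ground[OF indep_B] by blast
  qed
qed

text \<open>The closures of complementary parts of an independent set are skew, so independent sets
  in them have an independent union.\<close>

lemma indep_Un_of_disjoint_supports:
  assumes "indep M X" "indep M Y" "X \<inter> Y = {}"
    and "X \<subseteq> closure M T" "Y \<subseteq> closure M (B - T)" "T \<subseteq> B"
  shows "indep M (X \<union> Y)"
proof -
  have fin: "finite B" "finite X" "finite Y"
    using assms indep_B finite_indep by auto
  have r: "rank_of M T = card T" "rank_of M (B - T) = card (B - T)" "rank_of M B = card B"
    "rank_of M X = card X" "rank_of M Y = card Y"
    using assms indep_B by (auto intro!: rank_of_indep intro: indep_subset)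
  have card_B: "card T + card (B - T) = card B"
    using assms(6) fin by (simp add: card_Diff_subset card_mono finite_subset)
  \<comment> \<open>First \<open>X\<close> takes the place of \<open>T\<close> beside
    \<open>B - T\<close>: the rank of \<open>(B - T) \<union> X\<close> is at least
    \<open>card (B - T) + card X\<close>. Then, in \<open>s2\<close>, \<open>Y\<close> takes the
    place of \<open>B - T\<close> beside \<open>X\<close>.\<close>
  have s1: "rank_of M ((T \<union> X) \<union> ((B - T) \<union> X)) + rank_of M ((T \<union> X) \<inter> ((B - T) \<union> X))
      \<le> rank_of M (T \<union> X) + rank_of M ((B - T) \<union> X)"
    by (rule rank_of_submodular)
  have m1: "rank_of M B \<le> rank_of M ((T \<union> X) \<union> ((B - T) \<union> X))"
    "rank_of M X \<le> rank_of M ((T \<union> X) \<inter> ((B - T) \<union> X))"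
    by (auto intro!: rank_of_mono)
  have s2: "rank_of M ((X \<union> Y) \<union> ((B - T) \<union> Y)) + rank_of M ((X \<union> Y) \<inter> ((B - T) \<union> Y))
      \<le> rank_of M (X \<union> Y) + rank_of M ((B - T) \<union> Y)"
    by (rule rank_of_submodular)
  have m2: "rank_of M ((B - T) \<union> X) \<le> rank_of M ((X \<union> Y) \<union> ((B - T) \<union> Y))"
    "rank_of M Y \<le> rank_of M ((X \<union> Y) \<inter> ((B - T) \<union> Y))"
    by (auto intro!: rank_of_mono)
  have "card X + card Y \<le> rank_of M (X \<union> Y)"
    using s1 m1 s2 m2 r card_B rank_of_Un_closure[OF assms(4)] rank_of_Un_closure[OF assms(5)]
    by linarith
  then show ?thesis
    using fin assms(3) by (intro indep_if_card_le_rank_of) (auto simp: card_Un_disjoint)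
qed

text \<open>
  A circuit that meets \<open>B\<close> spans all the vertices of its graph, since the set of spanned vertices is
  closed under adjacency and a circuit cannot be split along complementary parts of \<open>B\<close>.
\<close>

lemma card_supports_circuit_less:
  assumes C: "\<not> indep M C" "\<And>D. D \<subset> C \<Longrightarrow> indep M D" "C \<subseteq> ground M" and b: "b \<in> C" "b \<in> B"
  shows "card (\<Union> (\<sigma> ` C)) < card C"
proof -
  let ?V = "\<Union> (\<sigma> ` C)"
  define T where "T = ?V \<inter> closure M C"
  \<comment> \<open>\<open>T\<close> consists of the vertices spanned by \<open>C\<close>, and
    \<open>C1\<close> of the edges that touch one of them. All ends of such edges are again in
    \<open>T\<close>, so the other edges have supports in \<open>B - T\<close>.\<close>
  define C1 where "C1 = {e \<in> C. \<sigma> e \<inter> T \<noteq> {}}"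
  define C2 where "C2 = C - C1"
  have finC: "finite C"
    using C(3) finite_ground finite_subset by blast
  have VB: "?V \<subseteq> B"
    using \<sigma> C(3) by blast
  have Ccl: "C \<subseteq> closure M C"
    using C(3) by (rule subset_closure)
  have "b \<in> T"
    using b Ccl support_basis_element[of b] by (auto simp: T_def)
  then have "b \<in> C1"
    using b support_basis_element by (auto simp: C1_def)
  have C1: "\<sigma> e \<subseteq> T" if e: "e \<in> C1" for e
  proof
    fix u assume u: "u \<in> \<sigma> e"
    obtain t where "t \<in> \<sigma> e" "t \<in> T" "e \<in> C"
      using e by (auto simp: C1_def)
    then have "u \<in> closure M {e, t}" "{e, t} \<subseteq> closure M C"
      using support_other_end u C(3) Ccl by (auto simp: T_def)
    then have "u \<in> closure M C"
      by (rule in_closure_trans)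
    then show "u \<in> T"
      using u \<open>e \<in> C\<close> by (auto simp: T_def)
  qed
  have "C2 = {}"
  proof (rule ccontr)
    assume "C2 \<noteq> {}"
    then have "C1 \<subset> C" "C2 \<subset> C"
      using \<open>b \<in> C1\<close> by (auto simp: C2_def C1_def)
    then have "indep M C1" "indep M C2"
      using C(2) by auto
    moreover have "C1 \<subseteq> closure M T"
    proof
      fix e assume "e \<in> C1"
      then have "\<sigma> e \<subseteq> T" "e \<in> ground M"
        using C1 C(3) by (auto simp: C1_def)
      then show "e \<in> closure M T"
        using \<sigma>[of e] in_closure_mono[of e "\<sigma> e" T] by simp
    qed
    moreover have "C2 \<subseteq> closure M (B - T)"
    proof
      fix e assume "e \<in> C2"
      then have "\<sigma> e \<subseteq> B - T" "e \<in> ground M"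
        using \<sigma>[of e] C(3) by (auto simp: C1_def C2_def)
      then show "e \<in> closure M (B - T)"
        using \<sigma>[of e] in_closure_mono[of e "\<sigma> e" "B - T"] by simp
    qed
    moreover have "T \<subseteq> B" "C1 \<inter> C2 = {}"
      using VB by (auto simp: T_def C2_def)
    ultimately have "indep M (C1 \<union> C2)"
      using indep_Un_of_disjoint_supports by blast
    moreover have "C1 \<union> C2 = C"
      by (auto simp: C1_def C2_def)
    ultimately show False
      using C(1) by simp
  qed
  then have "?V \<subseteq> closure M C"
    using C1 by (auto simp: C2_def T_def)
  then have "rank_of M ?V \<le> rank_of M C"
    using rank_of_Un_closure[of ?V C] rank_of_mono[of ?V "C \<union> ?V"] by simp
  moreover have "rank_of M ?V = card ?V"
    using VB indep_B indep_subset rank_of_indep by blast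
  moreover have "rank_of M C < card C"
    using C(1) finC indep_if_card_le_rank_of not_le by blast
  ultimately show ?thesis by simp
qed

text \<open>A circuit inside \<open>Z\<close> either avoids \<open>B\<close>, and then
  \<open>Z - B\<close> is dependent, or meets \<open>B\<close>, and then it has more edges than
  vertices.\<close>

lemma indep_iff_bicircular:
  assumes "Z \<subseteq> ground M"
  shows "indep M Z \<longleftrightarrow> indep M (Z - B) \<and> bicircular \<sigma> Z"
proof
  assume "indep M Z"
  then show "indep M (Z - B) \<and> bicircular \<sigma> Z"
    using bicircular_if_indep indep_subset by blast
next
  assume Z: "indep M (Z - B) \<and> bicircular \<sigma> Z"
  show "indep M Z"
  proof (rule ccontr)
    assume "\<not> indep M Z"
    then obtain C where C: "C \<subseteq> Z" "\<not> indep M C" "\<And>D. D \<subset> C \<Longrightarrow> indep M D"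
      using circuit_exists assms finite_ground finite_subset by metis
    have "\<not> C \<subseteq> Z - B"
      using C(2) Z indep_subset by blast
    then obtain b where "b \<in> C" "b \<in> B"
      using C(1) by blast
    then have "card (\<Union> (\<sigma> ` C)) < card C"
      using card_supports_circuit_less C assms by blast
    then show False
      using Z C(1) unfolding bicircular_def by (meson not_le)
  qed
qed

end

end

lemma (in matroid) rank_of_insert_outside:
  assumes "w \<notin> ground M"
  shows "rank_of M (insert w X) = rank_of M X"
proof -
  have "{card I | I. I \<subseteq> insert w X \<and> indep M I} = {card I | I. I \<subseteq> X \<and> indep M I}"
    using assms indep_subset_ground by blast
  then show ?thesis
    by (simp add: rank_of_def)
qed

section \<open>Pulling back a matroid along a map\<close>

text \<open>Elements that \<open>\<phi>\<close> maps outside \<open>ground N\<close> become loops.\<close>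

definition pull :: "'b matroid \<Rightarrow> ('a \<Rightarrow> 'b) \<Rightarrow> 'a set \<Rightarrow> 'a matroid" where
  "pull N \<phi> D = \<lparr>ground = D, indep = (\<lambda>X. X \<subseteq> D \<and> inj_on \<phi> X \<and> indep N (\<phi> ` X))\<rparr>"

lemma ground_pull [simp]: "ground (pull N \<phi> D) = D"
  by (simp add: pull_def)

lemma indep_pull: "indep (pull N \<phi> D) X \<longleftrightarrow> X \<subseteq> D \<and> inj_on \<phi> X \<and> indep N (\<phi> ` X)"
  by (simp add: pull_def)

lemma matroid_pull:
  assumes "matroid N" "finite D"
  shows "matroid (pull N \<phi> D)"
proof -
  interpret N: matroid N by fact
  show ?thesis
  proof
    show "finite (ground (pull N \<phi> D))"
      using assms(2) by simp
    show "X \<subseteq> ground (pull N \<phi> D)" if "indep (pull N \<phi> D) X" for X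
      using that by (simp add: indep_pull)
    show "indep (pull N \<phi> D) {}"
      by (simp add: indep_pull N.indep_empty)
    show "indep (pull N \<phi> D) Y" if "indep (pull N \<phi> D) X" "Y \<subseteq> X" for X Y
      using that N.indep_subset[of "\<phi> ` X" "\<phi> ` Y"] by (auto simp: indep_pull intro: inj_on_subset)
    show "\<exists>y \<in> Y - X. indep (pull N \<phi> D) (insert y X)"
      if "indep (pull N \<phi> D) X" "indep (pull N \<phi> D) Y" "card X < card Y" for X Y
    proof -
      have "indep N (\<phi> ` X)" "indep N (\<phi> ` Y)" "card (\<phi> ` X) < card (\<phi> ` Y)"
        using that by (auto simp: indep_pull card_image)
      then obtain z where z: "z \<in> \<phi> ` Y - \<phi> ` X" "indep N (insert z (\<phi> ` X))"
        using N.augmentation by blast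
      then obtain y where "y \<in> Y" "z = \<phi> y"
        by blast
      with z that show ?thesis
        by (intro bexI[of _ y]) (auto simp: indep_pull)
    qed
  qed
qed

lemma rank_of_pull:
  assumes "matroid N" "finite D" "A \<subseteq> D"
  shows "rank_of (pull N \<phi> D) A = rank_of N (\<phi> ` A)"
proof (rule antisym)
  interpret N: matroid N by fact
  interpret P: matroid "pull N \<phi> D"
    using assms by (intro matroid_pull)
  obtain I where I: "I \<subseteq> A" "indep (pull N \<phi> D) I" "rank_of (pull N \<phi> D) A = card I"
    by (rule P.rank_of_witness)
  then show "rank_of (pull N \<phi> D) A \<le> rank_of N (\<phi> ` A)"
    using N.card_le_rank_of[of "\<phi> ` I" "\<phi> ` A"] by (auto simp: indep_pull card_image)
  obtain J where J: "J \<subseteq> \<phi> ` A" "indep N J" "rank_of N (\<phi> ` A) = card J"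
    by (rule N.rank_of_witness)
  then obtain I where "I \<subseteq> A" "inj_on \<phi> I" "J = \<phi> ` I"
    by (meson subset_image_inj)
  with J assms(3) show "rank_of N (\<phi> ` A) \<le> rank_of (pull N \<phi> D) A"
    using P.card_le_rank_of[of I A] by (auto simp: indep_pull card_image)
qed

lemma in_closure_pull:
  assumes "matroid N" "finite D" "A \<subseteq> D" "e \<in> D"
    and "\<phi> e \<in> closure N (\<phi> ` A) \<or> \<phi> e \<notin> ground N"
  shows "e \<in> closure (pull N \<phi> D) A"
  using assms matroid.rank_of_insert_outside[of N "\<phi> e"]
  by (auto simp: closure_def rank_of_pull)

lemma pull_id:
  assumes "matroid M"
  shows "pull M id (ground M) = M"
  using matroid.indep_subset_ground[OF assms] by (auto simp: pull_def intro!: matroid.equality)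

section \<open>Frame representations\<close>

text \<open>Independence follows the formula of \<open>indep_iff_bicircular\<close>. For arbitrary
  \<open>\<sigma>\<close> the result may violate augmentation, so \<open>frame_rep\<close> demands
  the matroid axioms separately.\<close>

definition frame_ext :: "'a matroid \<Rightarrow> 'a set \<Rightarrow> ('a \<Rightarrow> 'a set) \<Rightarrow> 'a matroid" where
  "frame_ext M B \<sigma> = \<lparr>ground = ground M \<union> B,
     indep = (\<lambda>Z. Z \<subseteq> ground M \<union> B \<and> indep M (Z - B) \<and> bicircular \<sigma> Z)\<rparr>"

text \<open>The demand that independent sets of \<open>M\<close> be bicircular ensures that
  restricting \<open>frame_ext M B \<sigma>\<close> to \<open>ground M\<close> gives back
  \<open>M\<close>.\<close>

definition frame_rep :: "'a matroid \<Rightarrow> 'a set \<Rightarrow> ('a \<Rightarrow> 'a set) \<Rightarrow> bool" where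
  "frame_rep M B \<sigma> \<longleftrightarrow> finite B \<and> B \<inter> ground M = {} \<and> (\<forall>b \<in> B. \<sigma> b = {b})
     \<and> (\<forall>e \<in> ground M. \<sigma> e \<subseteq> B \<and> card (\<sigma> e) \<le> 2)
     \<and> (\<forall>X. indep M X \<longrightarrow> bicircular \<sigma> X) \<and> matroid (frame_ext M B \<sigma>)"

lemma ground_frame_ext [simp]: "ground (frame_ext M B \<sigma>) = ground M \<union> B"
  by (simp add: frame_ext_def)

lemma indep_frame_ext:
  "indep (frame_ext M B \<sigma>) Z \<longleftrightarrow> Z \<subseteq> ground M \<union> B \<and> indep M (Z - B) \<and> bicircular \<sigma> Z"
  by (simp add: frame_ext_def)

lemma bicircular_if_singletons:
  assumes "\<And>b. b \<in> Z \<Longrightarrow> \<sigma> b = {b}"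
  shows "bicircular \<sigma> Z"
proof -
  have "\<Union> (\<sigma> ` Y) = Y" if "Y \<subseteq> Z" for Y
    using that assms by force
  then show ?thesis
    by (simp add: bicircular_def)
qed

text \<open>With least supports as \<open>\<sigma>\<close>, \<open>indep_iff_bicircular\<close>
  identifies \<open>P\<close> with \<open>frame_ext M B \<sigma>\<close>.\<close>

lemma frame_rep_exists_if_spanned:
  assumes P: "matroid P" "ground P = ground M \<union> B" "B \<inter> ground M = {}"
    and M: "restrict P (ground M) = M" and B: "indep P B"
    and span: "\<And>e. e \<in> ground M \<Longrightarrow> \<exists>A \<subseteq> B. card A \<le> 2 \<and> e \<in> closure P A"
  shows "\<exists>\<sigma>. frame_rep M B \<sigma>"
proof -
  interpret P: matroid P by fact
  have finB: "finite B"
    using B by (rule P.finite_indep)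
  have span': "\<exists>A \<subseteq> B. card A \<le> 2 \<and> e \<in> closure P A" if "e \<in> ground P" for e
  proof (cases "e \<in> B")
    case True
    then show ?thesis
      using that P.subset_closure[of "{e}"] by (intro exI[of _ "{e}"]) auto
  qed (use that span P(2) in auto)
  obtain \<sigma> where \<sigma>: "\<And>e. e \<in> ground P \<Longrightarrow> \<sigma> e \<subseteq> B \<and> e \<in> closure P (\<sigma> e) \<and> card (\<sigma> e) \<le> 2
      \<and> (\<forall>A \<subseteq> B. e \<in> closure P A \<longrightarrow> \<sigma> e \<subseteq> A)"
    using P.least_supports_exist[OF B span'] by blast
  have ind: "indep M X \<longleftrightarrow> X \<subseteq> ground M \<and> indep P X" for X
    by (subst M[symmetric]) (simp add: restrict_def)
  have "indep (frame_ext M B \<sigma>) Z \<longleftrightarrow> indep P Z" for Z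
  proof (cases "Z \<subseteq> ground P")
    case True
    then have "Z - B \<subseteq> ground M"
      using P(2) by blast
    then show ?thesis
      using True P(2) P.indep_iff_bicircular[OF B \<sigma> True] by (simp add: indep_frame_ext ind)
  next
    case False
    then show ?thesis
      using P(2) P.indep_subset_ground by (auto simp: indep_frame_ext)
  qed
  then have "frame_ext M B \<sigma> = P"
    using P(2) by (intro matroid.equality) auto
  moreover have "bicircular \<sigma> X" if "indep M X" for X
    using P.bicircular_if_indep[OF B \<sigma>] that ind by blast
  moreover have "\<sigma> b = {b}" if "b \<in> B" for b
    using P.support_basis_element[OF B \<sigma> that] by simp
  ultimately have "frame_rep M B \<sigma>"
    using P finB \<sigma> by (auto simp: frame_rep_def)
  then show ?thesis by blast
qed

text \<open>The set \<open>\<sigma> e\<close> is independent as a subset of \<open>B\<close>, but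
  with \<open>e\<close> added it has one element more than it has vertices.\<close>

lemma in_closure_frame_ext:
  assumes "frame_rep M B \<sigma>" "e \<in> ground M"
  shows "e \<in> closure (frame_ext M B \<sigma>) (\<sigma> e)"
proof -
  interpret matroid "frame_ext M B \<sigma>"
    using assms(1) by (simp add: frame_rep_def)
  have rep: "\<sigma> e \<subseteq> B" "finite B" "B \<inter> ground M = {}" "\<And>b. b \<in> B \<Longrightarrow> \<sigma> b = {b}"
    using assms by (auto simp: frame_rep_def)
  have "indep (frame_ext M B \<sigma>) (\<sigma> e)"
    using rep indep_empty bicircular_if_singletons[of "\<sigma> e" \<sigma>]
    by (auto simp: indep_frame_ext Diff_eq_empty_iff[THEN iffD2])
  moreover have "\<Union> (\<sigma> ` insert e (\<sigma> e)) = \<sigma> e"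
    using rep by force
  then have "\<not> bicircular \<sigma> (insert e (\<sigma> e))"
    using rep assms(2) finite_subset[OF rep(1,2)] unfolding bicircular_def
    by (metis card_insert_disjoint disjoint_iff not_less_eq_eq order_refl subset_iff)
  ultimately show ?thesis
    using assms(2) by (intro in_closure_if_dependent_insert) (auto simp: indep_frame_ext)
qed

text \<open>The extension itself is the ambient matroid. All supports lie in \<open>B\<close>, so no
  bicircular set is larger than \<open>B\<close>, which makes \<open>B\<close> a basis.\<close>

lemma frame_matroid_if_rep:
  fixes M :: "'a::infinite matroid"
  assumes "matroid M" "frame_rep M B \<sigma>"
  shows "frame_matroid M"
proof -
  interpret M: matroid M by fact
  interpret N: matroid "frame_ext M B \<sigma>"
    using assms(2) by (simp add: frame_rep_def)
  have rep: "finite B" "B \<inter> ground M = {}" "\<And>b. b \<in> B \<Longrightarrow> \<sigma> b = {b}"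
    "\<And>e. e \<in> ground M \<Longrightarrow> \<sigma> e \<subseteq> B \<and> card (\<sigma> e) \<le> 2" "\<And>X. indep M X \<Longrightarrow> bicircular \<sigma> X"
    using assms(2) by (auto simp: frame_rep_def)
  have "X \<subseteq> ground M \<and> indep (frame_ext M B \<sigma>) X \<longleftrightarrow> indep M X" for X
  proof (cases "X \<subseteq> ground M")
    case True
    then have "X - B = X"
      using rep(2) by blast
    then show ?thesis
      using True rep(5) by (auto simp: indep_frame_ext)
  qed (use M.indep_subset_ground in blast)
  then have "restrict (frame_ext M B \<sigma>) (ground M) = M"
    by (intro matroid.equality) (auto simp: restrict_def)
  moreover have "basis (frame_ext M B \<sigma>) B"
    unfolding basis_def basis_in_def
  proof (intro conjI allI impI)
    show "indep (frame_ext M B \<sigma>) B"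
      using M.indep_empty rep(3) by (simp add: indep_frame_ext bicircular_if_singletons)
    fix B' assume B': "B \<subseteq> B'" "B' \<subseteq> ground (frame_ext M B \<sigma>)" "indep (frame_ext M B \<sigma>) B'"
    then have "bicircular \<sigma> B'"
      by (simp add: indep_frame_ext)
    then have "card B' \<le> card (\<Union> (\<sigma> ` B'))"
      by (auto simp: bicircular_def)
    moreover have "\<sigma> x \<subseteq> B" if "x \<in> B'" for x
    proof (cases "x \<in> B")
      case False
      then show ?thesis
        using that B'(2) rep(4)[of x] by auto
    qed (use rep(3) in simp)
    then have "\<Union> (\<sigma> ` B') \<subseteq> B"
      by blast
    then have "card (\<Union> (\<sigma> ` B')) \<le> card B"
      using rep(1) by (rule card_mono[rotated])
    ultimately show "B' = B"
      using card_seteq[OF N.finite_indep[OF B'(3)] B'(1)] by simp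
  qed simp
  moreover have "\<exists>A \<subseteq> B. card A \<le> 2 \<and> e \<in> closure (frame_ext M B \<sigma>) A"
    if "e \<in> ground (frame_ext M B \<sigma>)" for e
  proof (cases "e \<in> B")
    case True
    then show ?thesis
      using N.subset_closure[of "{e}"] by (intro exI[of _ "{e}"]) auto
  next
    case False
    then show ?thesis
      using that rep(4) in_closure_frame_ext[OF assms(2)] by (intro exI[of _ "\<sigma> e"]) auto
  qed
  ultimately show ?thesis
    unfolding frame_matroid_def using assms(1) N.matroid_axioms
    by (intro conjI exI[of _ "frame_ext M B \<sigma>"] exI[of _ B]) auto
qed

text \<open>
  The rank of the ambient matroid need not equal \<open>rank M\<close>; the part of its basis that supports a
  basis of \<open>M\<close> suffices.
\<close>

lemma pull_spanned_by_pairs: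
  fixes M :: "'a::infinite matroid" and \<phi> :: "'a \<Rightarrow> 'a"
  assumes "frame_matroid M" "finite D"
  obtains k where "k \<le> 2 * rank M"
    "\<And>B. finite B \<Longrightarrow> card B = k \<Longrightarrow> B \<inter> D = {} \<Longrightarrow>
      \<exists>P. matroid P \<and> ground P = D \<union> B \<and> restrict P D = pull M \<phi> D \<and> indep P B
        \<and> (\<forall>e \<in> D. \<exists>A \<subseteq> B. card A \<le> 2 \<and> e \<in> closure P A)"
proof -
  obtain N B' where N: "matroid N" "ground M \<subseteq> ground N" "restrict N (ground M) = M"
    and "basis N B'" and span: "\<forall>e \<in> ground N. \<exists>A \<subseteq> B'. card A \<le> 2 \<and> e \<in> closure N A"
    and "matroid M"
    using assms(1) unfolding frame_matroid_def by (elim conjE exE)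
  have B': "indep N B'"
    using \<open>basis N B'\<close> by (simp add: basis_def basis_in_def)
  interpret M: matroid M by fact
  interpret N: matroid N by fact
  have finB': "finite B'"
    using B' by (rule N.finite_indep)
  have ind: "indep M X \<longleftrightarrow> X \<subseteq> ground M \<and> indep N X" for X
    by (subst N(3)[symmetric]) (simp add: restrict_def)
  obtain S where S: "\<And>e. e \<in> ground N \<Longrightarrow> S e \<subseteq> B' \<and> e \<in> closure N (S e) \<and> card (S e) \<le> 2
      \<and> (\<forall>A \<subseteq> B'. e \<in> closure N A \<longrightarrow> S e \<subseteq> A)"
    using N.least_supports_exist[OF B' span[rule_format]] by blast
  obtain X where X: "basis_in M (ground M) X"
    by (rule M.basis_in_exists)
  then have Xg: "X \<subseteq> ground M" "indep M X" "X \<subseteq> ground N"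
    and X_max: "\<And>X'. X \<subseteq> X' \<Longrightarrow> indep M X' \<Longrightarrow> X' = X"
    using N(2) M.indep_subset_ground by (auto simp: basis_in_def)
  \<comment> \<open>The part of the ambient basis that supports the basis \<open>X\<close> of
    \<open>M\<close>, at most two elements for each element of \<open>X\<close>.\<close>
  define V where "V = \<Union> (S ` X)"
  have "V \<subseteq> B'"
    using S Xg by (auto simp: V_def)
  then have V: "finite V" "indep N V"
    using finB' B' by (auto intro: finite_subset N.indep_subset)
  have "card V \<le> (\<Sum>x\<in>X. card (S x))"
    unfolding V_def using M.finite_indep[OF Xg(2)] by (rule card_UN_le)
  also have "\<dots> \<le> (\<Sum>x\<in>X. 2)"
    using S Xg by (intro sum_mono) auto
  also have "\<dots> = 2 * rank M"
    using M.rank_of_eq_card_basis_in[OF X] by (simp add: rank_def)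
  finally have card_V: "card V \<le> 2 * rank M" .
  have X_V: "X \<subseteq> closure N V"
  proof
    fix x assume "x \<in> X"
    then show "x \<in> closure N V"
      using S[of x] Xg N.in_closure_mono[of x "S x" V] by (auto simp: V_def)
  qed
  \<comment> \<open>\<open>V\<close> spans \<open>X\<close> and hence every element of
    \<open>M\<close>, so by leastness all supports are inside \<open>V\<close>.\<close>
  have S_V: "S e \<subseteq> V" if e: "e \<in> ground M" for e
  proof -
    have "e \<in> closure N X"
    proof (cases "e \<in> X")
      case True
      then show ?thesis
        using N.subset_closure Xg by blast
    next
      case False
      then have "\<not> indep N (insert e X)"
        using X_max[of "insert e X"] e Xg by (auto simp: ind)
      then show ?thesis
        using e N(2) Xg ind by (intro N.in_closure_if_dependent_insert) auto
    qed
    then have "e \<in> closure N V"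
      using X_V by (rule N.in_closure_trans)
    then show ?thesis
      using S[of e] e N(2) \<open>V \<subseteq> B'\<close> by blast
  qed
  obtain w where w: "w \<notin> ground N"
    using arb_element[OF N.finite_ground] by blast
  show thesis
  proof (rule that[OF card_V])
    fix B :: "'a set" assume B: "finite B" "card B = card V" "B \<inter> D = {}"
    then obtain \<beta> where \<beta>: "bij_betw \<beta> B V"
      using V(1) finite_same_card_bij by blast
    \<comment> \<open>\<open>B\<close> becomes a copy of \<open>V\<close>. If
      \<open>\<phi> x\<close> is outside \<open>ground M\<close>, then \<open>x\<close> is a loop of
      the pullback of \<open>M\<close>; since \<open>\<phi> x\<close> may still belong to
      \<open>N\<close>, \<open>x\<close> is sent to \<open>w\<close>, which does not.\<close>
    define \<psi> where "\<psi> x = (if x \<in> D then if \<phi> x \<in> ground M then \<phi> x else w else \<beta> x)" for x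
    let ?P = "pull N \<psi> (D \<union> B)"
    have \<psi>_B: "\<psi> b = \<beta> b" if "b \<in> B" for b
      using that B(3) by (auto simp: \<psi>_def)
    have "inj_on \<psi> X \<and> indep N (\<psi> ` X) \<longleftrightarrow> inj_on \<phi> X \<and> indep M (\<phi> ` X)" if "X \<subseteq> D" for X
    proof (cases "\<phi> ` X \<subseteq> ground M")
      case True
      then have "\<psi> x = \<phi> x" if "x \<in> X" for x
        using that \<open>X \<subseteq> D\<close> by (auto simp: \<psi>_def)
      then have "inj_on \<psi> X \<longleftrightarrow> inj_on \<phi> X" "\<psi> ` X = \<phi> ` X"
        by (auto intro!: inj_on_cong image_cong)
      then show ?thesis
        using True by (simp add: ind)
    next
      case False
      then have "w \<in> \<psi> ` X"
        using that by (force simp: \<psi>_def image_iff)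
      then show ?thesis
        using False w N.indep_subset_ground M.indep_subset_ground by blast
    qed
    then have "restrict ?P D = pull M \<phi> D"
      by (intro matroid.equality) (auto simp: restrict_def indep_pull fun_eq_iff)
    moreover have "indep ?P B"
    proof -
      have "inj_on \<psi> B \<longleftrightarrow> inj_on \<beta> B" "\<psi> ` B = \<beta> ` B"
        using \<psi>_B by (auto intro!: inj_on_cong image_cong)
      then show ?thesis
        using \<beta> V by (auto simp: indep_pull bij_betw_def)
    qed
    moreover have "\<exists>A \<subseteq> B. card A \<le> 2 \<and> e \<in> closure ?P A" if e: "e \<in> D" for e
    proof (cases "\<phi> e \<in> ground M")
      case False
      then have "e \<in> closure ?P {}"
        using e w B assms(2) by (intro in_closure_pull N(1)) (auto simp: \<psi>_def)
      then show ?thesis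
        by (intro exI[of _ "{}"]) auto
    next
      case True
      define A where "A = inv_into B \<beta> ` S (\<phi> e)"
      have "S (\<phi> e) \<subseteq> \<beta> ` B"
        using S_V[OF True] \<beta> by (simp add: bij_betw_def)
      then have "\<beta> ` A = S (\<phi> e)" "A \<subseteq> B"
        by (auto simp: A_def image_inv_into_cancel inv_into_into subset_iff)
      moreover from this have "\<psi> ` A = \<beta> ` A"
        using \<psi>_B by (intro image_cong) auto
      moreover have "card A \<le> card (S (\<phi> e))"
        unfolding A_def using S_V[OF True] V(1) finite_subset by (blast intro: card_image_le)
      moreover have "card (S (\<phi> e)) \<le> 2" "\<phi> e \<in> closure N (S (\<phi> e))"
        using S[of "\<phi> e"] True N(2) by auto
      moreover have "\<psi> e = \<phi> e"
        using e True by (simp add: \<psi>_def)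
      ultimately show ?thesis
        using e B assms(2) by (intro exI[of _ A]) (auto intro!: in_closure_pull N(1))
    qed
    moreover have "matroid ?P"
      using B assms(2) N(1) by (intro matroid_pull) auto
    ultimately show "\<exists>P. matroid P \<and> ground P = D \<union> B \<and> restrict P D = pull M \<phi> D \<and> indep P B
        \<and> (\<forall>e \<in> D. \<exists>A \<subseteq> B. card A \<le> 2 \<and> e \<in> closure P A)"
      by (intro exI[of _ ?P]) auto
  qed
qed

text \<open>Only the size of \<open>B\<close> is prescribed, so that different deletions can later
  be represented over one common \<open>B\<close>.\<close>

lemma frame_rep_pull_exists:
  fixes M :: "'a::infinite matroid" and \<phi> :: "'a \<Rightarrow> 'a"
  assumes "frame_matroid M" "finite D"
  obtains k where "k \<le> 2 * rank M"
    "\<And>B. finite B \<Longrightarrow> card B = k \<Longrightarrow> B \<inter> D = {} \<Longrightarrow> \<exists>\<sigma>. frame_rep (pull M \<phi> D) B \<sigma>"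
proof -
  obtain k where k: "k \<le> 2 * rank M"
    "\<And>B. finite B \<Longrightarrow> card B = k \<Longrightarrow> B \<inter> D = {} \<Longrightarrow>
      \<exists>P. matroid P \<and> ground P = D \<union> B \<and> restrict P D = pull M \<phi> D \<and> indep P B
        \<and> (\<forall>e \<in> D. \<exists>A \<subseteq> B. card A \<le> 2 \<and> e \<in> closure P A)"
    using pull_spanned_by_pairs[OF assms] by blast
  show thesis
  proof (rule that[OF k(1)])
    fix B :: "'a set" assume B: "finite B" "card B = k" "B \<inter> D = {}"
    then obtain P where "matroid P" "ground P = D \<union> B" "restrict P D = pull M \<phi> D" "indep P B"
      "\<forall>e \<in> D. \<exists>A \<subseteq> B. card A \<le> 2 \<and> e \<in> closure P A"
      using k(2)[of B] by blast
    with B show "\<exists>\<sigma>. frame_rep (pull M \<phi> D) B \<sigma>"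
      by (intro frame_rep_exists_if_spanned[of P]) auto
  qed
qed

lemma exists_disjoint_set_of_card:
  assumes "finite (Y :: 'a::infinite set)"
  obtains B where "finite B" "card B = k" "B \<inter> Y = {}"
proof -
  have "infinite (UNIV - Y)"
    using assms infinite_UNIV by (simp add: Diff_infinite_finite)
  then obtain B where "B \<subseteq> UNIV - Y" "finite B" "card B = k"
    using infinite_arbitrarily_large by blast
  with that show thesis by blast
qed

text \<open>Frame matroids are thus closed under adding loops and parallel elements, which is how
  excluded minors are shown to be simple.\<close>

lemma frame_matroid_pull:
  fixes M :: "'a::infinite matroid" and \<phi> :: "'a \<Rightarrow> 'a"
  assumes "frame_matroid M" "finite D"
  shows "frame_matroid (pull M \<phi> D)"
proof -
  obtain k where k: "\<And>B. finite B \<Longrightarrow> card B = k \<Longrightarrow> B \<inter> D = {} \<Longrightarrow> \<exists>\<sigma>. frame_rep (pull M \<phi> D) B \<sigma>"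
    using frame_rep_pull_exists[OF assms] by metis
  obtain B :: "'a set" where "finite B" "card B = k" "B \<inter> D = {}"
    using exists_disjoint_set_of_card[OF assms(2)] .
  then obtain \<sigma> where "frame_rep (pull M \<phi> D) B \<sigma>"
    using k by blast
  moreover have "matroid (pull M \<phi> D)"
    using assms by (intro matroid_pull) (auto simp: frame_matroid_def)
  ultimately show ?thesis
    by (rule frame_matroid_if_rep[rotated])
qed

section \<open>Frame representations that agree locally\<close>

lemma ground_delete [simp]: "ground (delete M X) = ground M - X"
  by (auto simp: delete_def restrict_def)

lemma indep_delete: "indep (delete M X) I \<longleftrightarrow> I \<subseteq> ground M - X \<and> indep M I"
  by (simp add: delete_def restrict_def)

lemma (in matroid) rank_delete_le: "rank (delete M X) \<le> rank M"
proof -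
  interpret D: matroid "delete M X"
    by (rule matroid_delete)
  obtain I where "indep (delete M X) I" "rank (delete M X) = card I"
    using D.rank_of_witness by (metis rank_def)
  then show ?thesis
    using card_le_rank_of[of I "ground M"] by (auto simp: indep_delete rank_def)
qed

text \<open>
  Augmentation in the extension involves only few elements of \<open>M\<close>, so each instance can be checked
  in the extension of a single deletion.
\<close>

lemma frame_matroid_if_locally_rep:
  fixes M :: "'a::infinite matroid"
  assumes "matroid M" "finite B" "B \<inter> ground M = {}"
    and rep: "\<And>f. f \<in> F \<Longrightarrow> frame_rep (delete M {f}) B (\<sigma> f)"
    and loc: "\<And>Y. Y \<subseteq> ground M \<Longrightarrow> card Y \<le> 2 * rank M + 1 \<Longrightarrow> \<exists>f \<in> F. f \<notin> Y \<and> (\<forall>x \<in> Y. \<sigma> f x = \<tau> x)"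
  shows "frame_matroid M"
proof -
  interpret M: matroid M by fact
  define \<rho> where "\<rho> x = (if x \<in> B then {x} else \<tau> x)" for x
  have \<rho>_B: "\<rho> b = {b}" if "b \<in> B" for b
    using that by (simp add: \<rho>_def)
  \<comment> \<open>Both sides depend only on \<open>M\<close> on \<open>Z - B\<close> and on the
    supports on \<open>Z\<close>. These agree because \<open>Z - B\<close> lies in \<open>Y\<close>,
    which avoids \<open>f\<close>.\<close>
  have ext: "indep (frame_ext M B \<rho>) Z \<longleftrightarrow> indep (frame_ext (delete M {f}) B (\<sigma> f)) Z"
    if f: "f \<in> F" "f \<notin> Y" "\<forall>x \<in> Y. \<sigma> f x = \<tau> x" and Z: "Z \<subseteq> Y \<union> B" "Y \<subseteq> ground M" for f Y Z
  proof -
    have "\<rho> x = \<sigma> f x" if "x \<in> Z" for x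
      using that Z f(3) rep[OF f(1)] assms(3) by (cases "x \<in> B") (auto simp: \<rho>_def frame_rep_def)
    then have "bicircular \<rho> Z \<longleftrightarrow> bicircular (\<sigma> f) Z"
      by (rule bicircular_cong)
    moreover have "Z - B \<subseteq> ground M - {f}" "Z \<subseteq> ground M \<union> B" "Z \<subseteq> (ground M - {f}) \<union> B"
      using Z f(2) by auto
    ultimately show ?thesis
      by (simp add: indep_frame_ext indep_delete)
  qed
  have card_indep: "card X \<le> rank M" if "indep M X" for X
    using M.card_le_rank_of[OF that M.indep_subset_ground[OF that]] by (simp add: rank_def)
  have "frame_rep M B \<rho>"
    unfolding frame_rep_def
  proof (intro conjI ballI allI impI)
    fix e assume e: "e \<in> ground M"
    \<comment> \<open>The \<open>+ 1\<close> in the size limit admits the singleton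
      \<open>{e}\<close> even if the rank is 0.\<close>
    then obtain f where f: "f \<in> F" "f \<noteq> e" "\<sigma> f e = \<tau> e"
      using loc[of "{e}"] by auto
    then have "e \<in> ground (delete M {f})"
      using e by simp
    then have "\<sigma> f e \<subseteq> B \<and> card (\<sigma> f e) \<le> 2"
      using rep[OF f(1)] unfolding frame_rep_def by blast
    moreover have "\<rho> e = \<sigma> f e"
      using e f(3) assms(3) by (auto simp: \<rho>_def)
    ultimately show "\<rho> e \<subseteq> B" "card (\<rho> e) \<le> 2"
      by simp_all
  next
    fix X assume X: "indep M X"
    then have Xg: "X \<subseteq> ground M"
      by (rule M.indep_subset_ground)
    then obtain f where f: "f \<in> F" "f \<notin> X" "\<forall>x \<in> X. \<sigma> f x = \<tau> x"
      using loc[of X] card_indep[OF X] by auto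
    have "indep (delete M {f}) X"
      using X Xg f(2) by (auto simp: indep_delete)
    then have "bicircular (\<sigma> f) X"
      using rep[OF f(1)] unfolding frame_rep_def by blast
    moreover have "\<rho> x = \<sigma> f x" if "x \<in> X" for x
    proof -
      have "x \<notin> B"
        using that Xg assms(3) by blast
      then show ?thesis
        using that f(3) by (simp add: \<rho>_def)
    qed
    ultimately show "bicircular \<rho> X"
      using bicircular_cong[of X \<rho> "\<sigma> f"] by blast
  next
    show "matroid (frame_ext M B \<rho>)"
    proof
      show "finite (ground (frame_ext M B \<rho>))"
        using assms(2) M.finite_ground by simp
      show "X \<subseteq> ground (frame_ext M B \<rho>)" if "indep (frame_ext M B \<rho>) X" for X
        using that by (simp add: indep_frame_ext)
      show "indep (frame_ext M B \<rho>) {}"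
        by (simp add: indep_frame_ext M.indep_empty bicircular_def)
      show "indep (frame_ext M B \<rho>) Y" if "indep (frame_ext M B \<rho>) X" "Y \<subseteq> X" for X Y
        unfolding indep_frame_ext
      proof (intro conjI)
        show "indep M (Y - B)"
          using that by (intro M.indep_subset[of "X - B" "Y - B"]) (auto simp: indep_frame_ext)
      qed (use that bicircular_subset[of \<rho> X Y] in \<open>auto simp: indep_frame_ext\<close>)
      show "\<exists>y \<in> Z' - Z. indep (frame_ext M B \<rho>) (insert y Z)"
        if Z: "indep (frame_ext M B \<rho>) Z" "indep (frame_ext M B \<rho>) Z'" "card Z < card Z'" for Z Z'
      proof -
        \<comment> \<open>The exchange takes place inside \<open>?Y \<union> B\<close>. Here
          \<open>?Y\<close> is a union of two independent sets of \<open>M\<close>, so its size is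
          at most \<open>2 * rank M\<close>, whatever the size of \<open>B\<close>.\<close>
        let ?Y = "(Z - B) \<union> (Z' - B)"
        have ZB: "indep M (Z - B)" "indep M (Z' - B)"
          using Z by (auto simp: indep_frame_ext)
        then have Y: "?Y \<subseteq> ground M"
          using M.indep_subset_ground by blast
        have "card ?Y \<le> card (Z - B) + card (Z' - B)"
          by (rule card_Un_le)
        also have "\<dots> \<le> 2 * rank M + 1"
          using card_indep[OF ZB(1)] card_indep[OF ZB(2)] by simp
        finally obtain f where f: "f \<in> F" "f \<notin> ?Y" "\<forall>x \<in> ?Y. \<sigma> f x = \<tau> x"
          using loc[OF Y] by blast
        note ext = ext[OF f _ Y]
        interpret N: matroid "frame_ext (delete M {f}) B (\<sigma> f)"
          using rep[OF f(1)] by (simp add: frame_rep_def)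
        have "indep (frame_ext (delete M {f}) B (\<sigma> f)) Z" "indep (frame_ext (delete M {f}) B (\<sigma> f)) Z'"
          using Z ext[of Z] ext[of Z'] by auto
        then obtain y where y: "y \<in> Z' - Z" "indep (frame_ext (delete M {f}) B (\<sigma> f)) (insert y Z)"
          using N.augmentation Z(3) by blast
        moreover have "insert y Z \<subseteq> ?Y \<union> B"
          using y(1) by blast
        ultimately show ?thesis
          using ext by blast
      qed
    qed
  qed (use assms \<rho>_B in auto)
  then show ?thesis
    by (rule frame_matroid_if_rep[OF assms(1)])
qed

section \<open>Supports of the elements of a line\<close>

text \<open>In the extension \<open>z\<close> is spanned by \<open>x\<close> and \<open>y\<close>,
  hence by \<open>\<sigma> x \<union> \<sigma> y\<close>. That \<open>\<sigma> z\<close> is the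
  least support is then recovered by counting.\<close>

lemma support_subset_if_dependent:
  assumes "frame_rep M B \<sigma>" "matroid M" "indep M {x, y}" "indep M {z}" "\<not> indep M {x, y, z}"
  shows "\<sigma> z \<subseteq> \<sigma> x \<union> \<sigma> y"
proof -
  interpret M: matroid M by fact
  interpret N: matroid "frame_ext M B \<sigma>"
    using assms(1) by (simp add: frame_rep_def)
  have rep: "finite B" "B \<inter> ground M = {}" "\<And>b. b \<in> B \<Longrightarrow> \<sigma> b = {b}"
    "\<And>e. e \<in> ground M \<Longrightarrow> \<sigma> e \<subseteq> B" "\<And>X. indep M X \<Longrightarrow> bicircular \<sigma> X"
    using assms(1) by (auto simp: frame_rep_def)
  have g: "x \<in> ground M" "y \<in> ground M" "z \<in> ground M"
    using assms M.indep_subset_ground by auto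
  have diff: "{x, y} - B = {x, y}" "insert z {x, y} - B = {x, y, z}" "{z} - B = {z}"
    using g rep(2) by auto
  let ?S = "\<sigma> x \<union> \<sigma> y"
  have S: "?S \<subseteq> B"
    using rep(4) g by blast
  then have S': "finite ?S" "z \<notin> ?S"
    using rep(1,2) g(3) finite_subset by blast+
  have "indep (frame_ext M B \<sigma>) {x, y}"
    using assms(3) rep(5) g unfolding indep_frame_ext diff by auto
  moreover have "\<not> indep (frame_ext M B \<sigma>) (insert z {x, y})"
    using assms(5) unfolding indep_frame_ext diff by simp
  ultimately have "z \<in> closure (frame_ext M B \<sigma>) {x, y}"
    using g by (intro N.in_closure_if_dependent_insert) auto
  moreover have "{x, y} \<subseteq> closure (frame_ext M B \<sigma>) ?S"
    using g in_closure_frame_ext[OF assms(1)] N.in_closure_mono[of _ "\<sigma> x" ?S]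
      N.in_closure_mono[of _ "\<sigma> y" ?S] by auto
  ultimately have "z \<in> closure (frame_ext M B \<sigma>) ?S"
    by (rule N.in_closure_trans)
  then have "\<not> indep (frame_ext M B \<sigma>) (insert z ?S)"
    using S' by (intro N.dependent_insert_if_in_closure)
  moreover have "insert z ?S - B = {z}" "insert z ?S \<subseteq> ground M \<union> B"
    using S g rep(2) by auto
  ultimately have "\<not> bicircular \<sigma> (insert z ?S)"
    using assms(4) unfolding indep_frame_ext by metis
  \<comment> \<open>Elements of \<open>B\<close> are their own supports, so a violating
    \<open>Y\<close> contains \<open>z\<close>, and \<open>\<sigma> z\<close> adds nothing to
    \<open>Y - {z}\<close>.\<close>
  then obtain Y where Y: "Y \<subseteq> insert z ?S" "card (\<Union> (\<sigma> ` Y)) < card Y"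
    by (auto simp: bicircular_def not_le)
  let ?Y = "Y - {z}"
  have "?Y \<subseteq> B" "finite ?Y"
    using Y(1) S S'(1) finite_subset[of ?Y ?S] by auto
  then have "\<Union> (\<sigma> ` ?Y) = ?Y"
    using rep(3) by force
  have "z \<in> Y"
  proof (rule ccontr)
    assume "z \<notin> Y"
    then show False
      using Y(2) \<open>\<Union> (\<sigma> ` ?Y) = ?Y\<close> by simp
  qed
  then have "\<Union> (\<sigma> ` Y) = ?Y \<union> \<sigma> z"
    using \<open>\<Union> (\<sigma> ` ?Y) = ?Y\<close> by blast
  moreover have "card Y = Suc (card ?Y)"
    using \<open>z \<in> Y\<close> \<open>finite ?Y\<close> by (intro card.remove) simp_all
  ultimately have "card (?Y \<union> \<sigma> z) \<le> card ?Y"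
    using Y(2) by simp
  moreover have "finite (\<sigma> z)"
    using rep(1,4) g finite_subset by blast
  ultimately have "?Y = ?Y \<union> \<sigma> z"
    using \<open>finite ?Y\<close> by (intro card_seteq) auto
  then show ?thesis
    using Y(1) by blast
qed

text \<open>Two elements of \<open>L\<close> whose supports miss a vertex would exclude it from all
  supports, so each of three vertices is missed by at most one element. A fourth element would then
  have all three in its support.\<close>

lemma card_supports_line_le:
  assumes "frame_rep M B \<sigma>" "matroid M" "L \<subseteq> ground M" "4 \<le> card L"
    and pairs: "\<And>x y. x \<in> L \<Longrightarrow> y \<in> L \<Longrightarrow> indep M {x, y}"
    and triples: "\<And>x y z. x \<in> L \<Longrightarrow> y \<in> L \<Longrightarrow> z \<in> L \<Longrightarrow> x \<noteq> y \<Longrightarrow> x \<noteq> z \<Longrightarrow> y \<noteq> z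
      \<Longrightarrow> \<not> indep M {x, y, z}"
  shows "card (\<Union> (\<sigma> ` L)) \<le> 2"
proof (rule ccontr)
  assume "\<not> card (\<Union> (\<sigma> ` L)) \<le> 2"
  then obtain T where T: "T \<subseteq> \<Union> (\<sigma> ` L)" "card T = 3" "finite T"
    using obtain_subset_with_card_n[of 3 "\<Union> (\<sigma> ` L)"] by force
  have finL: "finite L"
    using assms(4) by (intro card_ge_0_finite) simp
  have sub: "\<sigma> z \<subseteq> \<sigma> x \<union> \<sigma> y" if "x \<in> L" "y \<in> L" "z \<in> L" "x \<noteq> y" for x y z
  proof (cases "z = x \<or> z = y")
    case False
    then have "\<not> indep M {x, y, z}"
      using that by (intro triples) auto
    then show ?thesis
      using that pairs[of x y] pairs[of z z] by (intro support_subset_if_dependent[OF assms(1,2)]) auto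
  qed auto
  have miss: "card {x \<in> L. v \<notin> \<sigma> x} \<le> 1" if v: "v \<in> T" for v
  proof -
    obtain z where "z \<in> L" "v \<in> \<sigma> z"
      using v T(1) by blast
    then have "x = y" if "x \<in> L" "v \<notin> \<sigma> x" "y \<in> L" "v \<notin> \<sigma> y" for x y
      using that sub[of x y z] by blast
    then show ?thesis
      using finL by (auto simp: card_le_Suc0_iff_eq)
  qed
  have "card (\<Union>v\<in>T. {x \<in> L. v \<notin> \<sigma> x}) \<le> (\<Sum>v\<in>T. card {x \<in> L. v \<notin> \<sigma> x})"
    using T(3) by (rule card_UN_le)
  also have "\<dots> \<le> (\<Sum>v\<in>T. 1)"
    by (rule sum_mono) (rule miss)
  also have "\<dots> < card L"
    using T(2) assms(4) by simp
  finally have "card (\<Union>v\<in>T. {x \<in> L. v \<notin> \<sigma> x}) < card L" .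
  moreover have "finite (\<Union>v\<in>T. {x \<in> L. v \<notin> \<sigma> x})"
    using finL T(3) by simp
  ultimately have "\<not> L \<subseteq> (\<Union>v\<in>T. {x \<in> L. v \<notin> \<sigma> x})"
    using card_mono not_le by blast
  then obtain x where x: "x \<in> L" "T \<subseteq> \<sigma> x"
    by blast
  then have "\<sigma> x \<subseteq> B" "card (\<sigma> x) \<le> 2" "finite B"
    using assms(1,3) by (auto simp: frame_rep_def)
  then show False
    using card_mono[OF _ x(2)] T(2) finite_subset[of "\<sigma> x" B] by simp
qed

section \<open>Pigeonhole arguments\<close>

lemma pigeonhole_fibre:
  assumes "finite F" "h ` F \<subseteq> C" "finite C" "card C * n < card F"
  obtains c where "c \<in> C" "n < card {f \<in> F. h f = c}"
proof (rule ccontr)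
  assume "\<not> thesis"
  then have le: "card {f \<in> F. h f = c} \<le> n" if "c \<in> C" for c
    using that \<open>\<And>c. c \<in> C \<Longrightarrow> n < card {f \<in> F. h f = c} \<Longrightarrow> thesis\<close> by (meson not_le)
  have "card F \<le> card (\<Union>c\<in>C. {f \<in> F. h f = c})"
    using assms by (intro card_mono) auto
  also have "\<dots> \<le> (\<Sum>c\<in>C. card {f \<in> F. h f = c})"
    using assms(3) by (rule card_UN_le)
  also have "\<dots> \<le> (\<Sum>c\<in>C. n)"
    by (rule sum_mono) (rule le)
  finally show False
    using assms(4) by simp
qed

text \<open>The base value leaves some \<open>f\<close> outside any set of \<open>m\<close>
  elements. The recursive value allows for discarding \<open>m\<close> elements and then splitting
  into \<open>m * l\<close> fibres, one of which must exceed the previous bound.\<close>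

primrec agree_bound :: "nat \<Rightarrow> nat \<Rightarrow> nat \<Rightarrow> nat" where
  "agree_bound m l 0 = Suc m"
| "agree_bound m l (Suc c) = Suc (m + m * l * agree_bound m l c)"

text \<open>
  If the pattern \<open>P\<close> fails on a small set \<open>Y\<close>, then many \<open>f\<close> deviate from it at a common element of
  \<open>Y\<close> in the same way; changing \<open>P\<close> there reduces the number of deviations.
\<close>

lemma locally_agreeing_pattern:
  assumes "finite F" "agree_bound m l c \<le> card F" "finite L" "card L \<le> l"
    and "\<And>f x. f \<in> F \<Longrightarrow> x \<in> E \<Longrightarrow> x \<noteq> f \<Longrightarrow> \<sigma> f x \<in> L"
    and "\<And>f. f \<in> F \<Longrightarrow> card {x \<in> E. x \<noteq> f \<and> \<sigma> f x \<noteq> P x} \<le> c"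
    and "finite E"
  shows "\<exists>\<tau>. \<forall>Y \<subseteq> E. card Y \<le> m \<longrightarrow> (\<exists>f \<in> F. f \<notin> Y \<and> (\<forall>x \<in> Y. \<sigma> f x = \<tau> x))"
  using assms
proof (induction c arbitrary: F P)
  case 0
  have "\<exists>f \<in> F. f \<notin> Y \<and> (\<forall>x \<in> Y. \<sigma> f x = P x)" if Y: "Y \<subseteq> E" "card Y \<le> m" for Y
  proof -
    have "\<not> F \<subseteq> Y"
      using 0 Y card_mono[of Y F] finite_subset[of Y E] by auto
    then obtain f where f: "f \<in> F" "f \<notin> Y"
      by blast
    then have "{x \<in> E. x \<noteq> f \<and> \<sigma> f x \<noteq> P x} = {}"
      using 0(6)[OF f(1)] 0(7) by (subst card_0_eq[symmetric]) auto
    then show ?thesis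
      using f Y(1) by blast
  qed
  then show ?case by blast
next
  case (Suc c)
  show ?case
  proof (cases "\<forall>Y \<subseteq> E. card Y \<le> m \<longrightarrow> (\<exists>f \<in> F. f \<notin> Y \<and> (\<forall>x \<in> Y. \<sigma> f x = P x))")
    case False
    then obtain Y where Y: "Y \<subseteq> E" "card Y \<le> m"
      and no: "\<not> (\<exists>f \<in> F. f \<notin> Y \<and> (\<forall>x \<in> Y. \<sigma> f x = P x))"
      by blast
    have "\<forall>f \<in> F - Y. \<exists>y. y \<in> Y \<and> \<sigma> f y \<noteq> P y"
      using no by blast
    then obtain h where "\<forall>f \<in> F - Y. h f \<in> Y \<and> \<sigma> f (h f) \<noteq> P (h f)"
      by (rule bchoice[THEN exE])
    then have h: "\<And>f. f \<in> F - Y \<Longrightarrow> h f \<in> Y \<and> \<sigma> f (h f) \<noteq> P (h f)"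
      by blast
    have finY: "finite Y"
      using Y(1) Suc.prems(7) finite_subset by blast
    \<comment> \<open>Each \<open>f\<close> is coloured by an element of \<open>Y\<close> where it
      deviates from \<open>P\<close> and by its value there.\<close>
    have range: "(\<lambda>f. (h f, \<sigma> f (h f))) ` (F - Y) \<subseteq> Y \<times> L"
      using h Suc.prems(5) Y(1) by fastforce
    have "card (Y \<times> L) \<le> m * l"
      using Y(2) Suc.prems(4) by (simp add: card_cartesian_product mult_mono)
    then have "card (Y \<times> L) * agree_bound m l c \<le> m * l * agree_bound m l c"
      by (rule mult_right_mono) simp
    also have "\<dots> < card F - card Y"
      using Suc.prems(2) Y(2) by simp
    also have "\<dots> \<le> card (F - Y)"
      using finY by (rule diff_card_le_card_Diff)
    finally have many: "card (Y \<times> L) * agree_bound m l c < card (F - Y)" .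
    obtain p where p: "p \<in> Y \<times> L"
      "agree_bound m l c < card {f \<in> F - Y. (h f, \<sigma> f (h f)) = p}"
      using pigeonhole_fibre[OF _ range _ many] Suc.prems(1,3) finY by blast
    obtain y v where yv: "p = (y, v)"
      by (cases p)
    let ?F = "{f \<in> F - Y. (h f, \<sigma> f (h f)) = p}"
    have "\<exists>\<tau>. \<forall>Y \<subseteq> E. card Y \<le> m \<longrightarrow> (\<exists>f \<in> ?F. f \<notin> Y \<and> (\<forall>x \<in> Y. \<sigma> f x = \<tau> x))"
    proof (rule Suc.IH[of ?F "P(y := v)"])
      fix f assume f: "f \<in> ?F"
      let ?D = "{x \<in> E. x \<noteq> f \<and> \<sigma> f x \<noteq> P x}" and ?D' = "{x \<in> E. x \<noteq> f \<and> \<sigma> f x \<noteq> (P(y := v)) x}"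
      have "y \<in> Y" "\<sigma> f y = v" "\<sigma> f y \<noteq> P y" "y \<noteq> f"
        using f h[of f] yv by auto
      then have "?D' \<subseteq> ?D - {y}" "y \<in> ?D"
        using Y(1) by auto
      then have "?D' \<subset> ?D"
        by blast
      then have "card ?D' < card ?D"
        using Suc.prems(7) by (intro psubset_card_mono) auto
      then show "card ?D' \<le> c"
        using Suc.prems(6)[of f] f by simp
    qed (use Suc.prems p in auto)
    then obtain \<tau> where \<tau>: "\<forall>Y \<subseteq> E. card Y \<le> m \<longrightarrow> (\<exists>f \<in> ?F. f \<notin> Y \<and> (\<forall>x \<in> Y. \<sigma> f x = \<tau> x))"
      ..
    have "\<exists>f \<in> F. f \<notin> Z \<and> (\<forall>x \<in> Z. \<sigma> f x = \<tau> x)" if "Z \<subseteq> E" "card Z \<le> m" for Z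
      using \<tau>[rule_format, OF that] by fast
    then show ?thesis
      by (intro exI[of _ \<tau>]) simp
  qed (rule exI[of _ P])
qed

section \<open>Excluded minors are simple\<close>

text \<open>A basis of \<open>insert y X\<close> through \<open>y\<close> cannot contain
  \<open>x\<close>, but has at least \<open>card X\<close> elements, so it is all of the remaining
  set.\<close>

lemma (in matroid) indep_swap_parallel:
  assumes "indep M X" "x \<in> X" "\<not> indep M {x, y}" "indep M {y}"
  shows "y \<notin> X \<and> indep M (insert y (X - {x}))"
proof
  show "y \<notin> X"
    using assms indep_subset[of X "{x, y}"] by auto
  obtain I where I: "basis_in M (insert y X) I" "{y} \<subseteq> I"
    using indep_extends_to_basis_in[of "{y}" "insert y X"] assms(4) by blast
  then have I': "indep M I" "I \<subseteq> insert y X"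
    by (auto simp: basis_in_def)
  moreover have "x \<notin> I"
    using I(2) I'(1) assms(3) indep_subset[of I "{x, y}"] by auto
  moreover have "finite X"
    using assms(1) by (rule finite_indep)
  moreover have "card (insert y (X - {x})) = card X"
    using \<open>y \<notin> X\<close> \<open>finite X\<close> assms(2) by (metis DiffD1 card_insert_disjoint card.remove finite_Diff)
  moreover have "card X \<le> card I"
    using card_basis_in_ge[OF I(1) assms(1)] by blast
  ultimately have "I = insert y (X - {x})"
    by (intro card_seteq) auto
  then show "indep M (insert y (X - {x}))"
    using I'(1) by simp
qed

context matroid
begin

text \<open>The deletion lacks \<open>x\<close>, so pulling back along \<open>id\<close> restores it
  as a loop.\<close>

lemma pull_delete_loop:
  assumes "\<not> indep M {x}"
  shows "pull (delete M {x}) id (ground M) = M"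
proof -
  have "X \<subseteq> ground M - {x}" if "indep M X" for X
    using that assms indep_subset_ground[OF that] indep_subset[of X "{x}"] by auto
  then have "indep (pull (delete M {x}) id (ground M)) X \<longleftrightarrow> indep M X" for X
    unfolding indep_pull indep_delete by auto
  then show ?thesis
    by (intro matroid.equality) auto
qed

text \<open>Sending \<open>x\<close> to \<open>y\<close> restores \<open>x\<close> as a copy of
  \<open>y\<close>: injectivity excludes sets containing both, and the remaining sets through
  \<open>x\<close> are handled by swapping.\<close>

lemma pull_delete_parallel:
  assumes "x \<noteq> y" "y \<in> ground M" "indep M {x}" "indep M {y}" "\<not> indep M {x, y}"
  shows "pull (delete M {x}) (id(x := y)) (ground M) = M"
proof -
  let ?\<phi> = "id(x := y)"
  have "indep (pull (delete M {x}) ?\<phi> (ground M)) X \<longleftrightarrow> indep M X" if X: "X \<subseteq> ground M" for X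
  proof (cases "x \<in> X")
    case False
    then have "?\<phi> ` X = X" "inj_on ?\<phi> X"
      by (auto simp: inj_on_def)
    then show ?thesis
      using X False by (auto simp: indep_pull indep_delete)
  next
    case True
    let ?X = "insert y (X - {x})"
    have "?\<phi> ` X = ?X"
      using True by auto
    moreover have "inj_on ?\<phi> X \<longleftrightarrow> y \<notin> X"
      using True assms(1) by (auto simp: inj_on_def split: if_splits)
    ultimately have "indep (pull (delete M {x}) ?\<phi> (ground M)) X \<longleftrightarrow> y \<notin> X \<and> indep M ?X"
      using X assms(1,2) by (auto simp: indep_pull indep_delete)
    also have "\<dots> \<longleftrightarrow> indep M X"
    proof
      assume "y \<notin> X \<and> indep M ?X"
      then have "indep M (insert x (?X - {y}))"
        using indep_swap_parallel[of ?X y x] assms by (simp add: insert_commute)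
      moreover have "insert x (?X - {y}) = X"
        using True \<open>y \<notin> X \<and> indep M ?X\<close> by blast
      ultimately show "indep M X"
        by simp
    qed (use indep_swap_parallel True assms in blast)
    finally show ?thesis .
  qed
  then have "indep (pull (delete M {x}) ?\<phi> (ground M)) X \<longleftrightarrow> indep M X" for X
    using indep_subset_ground[of X] indep_pull[of "delete M {x}" ?\<phi> "ground M" X] by blast
  then show ?thesis
    by (intro matroid.equality) auto
qed

lemma contract_empty: "contract M {} = M"
proof -
  have "basis_in M {} B \<longleftrightarrow> B = {}" for B
    using indep_empty by (auto simp: basis_in_def)
  then have "indep (contract M {}) I \<longleftrightarrow> I \<subseteq> ground M \<and> indep M I" for I
    by (simp add: contract_def)
  then have "indep (contract M {}) I \<longleftrightarrow> indep M I" for I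
    using indep_subset_ground[of I] by blast
  then show ?thesis
    by (intro matroid.equality) (auto simp: contract_def fun_eq_iff)
qed

lemma proper_minor_delete:
  assumes "e \<in> ground M"
  shows "proper_minor (delete M {e}) M"
proof -
  have "minor (delete M {e}) M"
    unfolding minor_def using assms contract_empty by (intro exI[of _ "{}"] exI[of _ "{e}"]) simp
  moreover have "ground (delete M {e}) \<noteq> ground M"
    using assms by auto
  ultimately show ?thesis
    by (metis proper_minor_def)
qed

end

text \<open>A loop or a parallel pair would make \<open>M\<close> a pullback of one of its
  deletions, hence a frame matroid.\<close>

lemma indep_pair_excluded_minor:
  fixes M :: "'a::infinite matroid"
  assumes M: "excluded_minor {M. frame_matroid M} M" and xy: "x \<in> ground M" "y \<in> ground M"
  shows "indep M {x, y}"
proof -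
  interpret matroid M
    using M by (simp add: excluded_minor_def)
  have del: "frame_matroid (delete M {e})" if "e \<in> ground M" for e
    using M proper_minor_delete[OF that] unfolding excluded_minor_def by blast
  have pull: "pull (delete M {e}) \<phi> (ground M) \<noteq> M" if "e \<in> ground M" for e \<phi>
    using frame_matroid_pull[OF del[OF that] finite_ground, of \<phi>] M
    unfolding excluded_minor_def by (metis mem_Collect_eq)
  have nonloop: "indep M {e}" if "e \<in> ground M" for e
    using pull[OF that] pull_delete_loop by blast
  show ?thesis
  proof (cases "x = y")
    case False
    then show ?thesis
      using pull[OF xy(1)] pull_delete_parallel[OF False xy(2) nonloop[OF xy(1)] nonloop[OF xy(2)]]
      by blast
  qed (use nonloop xy in simp)
qed

section \<open>Excluded minors of given rank have bounded size\<close>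

lemma frame_rep_exists:
  fixes M :: "'a::infinite matroid"
  assumes "frame_matroid M"
  obtains k where "k \<le> 2 * rank M"
    "\<And>B. finite B \<Longrightarrow> card B = k \<Longrightarrow> B \<inter> ground M = {} \<Longrightarrow> \<exists>\<sigma>. frame_rep M B \<sigma>"
proof -
  have "matroid M"
    using assms by (simp add: frame_matroid_def)
  then show thesis
    using frame_rep_pull_exists[OF assms, of "ground M" id] that
    by (metis matroid.finite_ground pull_id)
qed

text \<open>The factors count the possible sizes of \<open>B\<close>, bound the number of relations
  between \<open>Pow B\<close> and \<open>B\<close>, and leave enough deletions for
  \<open>locally_agreeing_pattern\<close>.\<close>

definition size_bound :: "nat \<Rightarrow> nat" where
  "size_bound r = (2 * r + 1) * (2 ^ (4 ^ r * (2 * r))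
     * agree_bound (2 * r + 1) (4 ^ r) (1 + 4 ^ r * 4 + 2 * r))"

text \<open>
  A line of a deletion with at least four elements lies on a single edge \<open>{u, v}\<close> of the graph, and
  each vertex is parallel to at most one element. So, fixing one representation \<open>\<sigma> g\<close> and the pairs
  \<open>Q f\<close> that \<open>\<sigma> f\<close> assigns to its lines, \<open>\<sigma> f\<close> is determined up to boundedly many elements.
\<close>

lemma card_ground_excluded_minor_le:
  fixes M :: "'a::infinite matroid"
  assumes M: "excluded_minor {M. frame_matroid M} M"
  shows "card (ground M) \<le> size_bound (rank M)"
proof (rule ccontr)
  interpret M: matroid M
    using M by (simp add: excluded_minor_def)
  let ?E = "ground M"
  define r where "r = rank M"
  define c where "c = 1 + 4 ^ r * 4 + 2 * r"
  define A where "A = agree_bound (2 * r + 1) (4 ^ r) c"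
  assume "\<not> card ?E \<le> size_bound (rank M)"
  then have large: "card {..2 * r} * (2 ^ (4 ^ r * (2 * r)) * A) < card ?E"
    by (simp add: size_bound_def r_def A_def c_def not_le)
  have "\<exists>k \<le> 2 * r. \<forall>B. finite B \<longrightarrow> card B = k \<longrightarrow> B \<inter> ?E = {} \<longrightarrow> (\<exists>\<sigma>. frame_rep (delete M {f}) B \<sigma>)"
    if f: "f \<in> ?E" for f
  proof -
    have "frame_matroid (delete M {f})"
      using M M.proper_minor_delete[OF f] by (simp add: excluded_minor_def)
    then obtain k where k: "k \<le> 2 * rank (delete M {f})"
      "\<And>B. finite B \<Longrightarrow> card B = k \<Longrightarrow> B \<inter> ground (delete M {f}) = {} \<Longrightarrow> \<exists>\<sigma>. frame_rep (delete M {f}) B \<sigma>"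
      using frame_rep_exists by blast
    have "k \<le> 2 * r"
      using k(1) M.rank_delete_le[of "{f}"] by (simp add: r_def)
    moreover have "\<exists>\<sigma>. frame_rep (delete M {f}) B \<sigma>" if "finite B" "card B = k" "B \<inter> ?E = {}" for B
      using k(2)[of B] that by auto
    ultimately show ?thesis
      by blast
  qed
  then obtain kf where kf: "\<And>f. f \<in> ?E \<Longrightarrow> kf f \<le> 2 * r"
    "\<And>f B. f \<in> ?E \<Longrightarrow> finite B \<Longrightarrow> card B = kf f \<Longrightarrow> B \<inter> ?E = {} \<Longrightarrow> \<exists>\<sigma>. frame_rep (delete M {f}) B \<sigma>"
    by metis
  \<comment> \<open>Fixing the size \<open>k\<close> lets all the deletions retained share one set
    \<open>B\<close>.\<close>
  obtain k where k: "k \<in> {..2 * r}" "2 ^ (4 ^ r * (2 * r)) * A < card {f \<in> ?E. kf f = k}"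
    using pigeonhole_fibre[OF M.finite_ground, of kf "{..2 * r}"] large kf(1) by blast
  define F where "F = {f \<in> ?E. kf f = k}"
  have F: "F \<subseteq> ?E" "finite F"
    using M.finite_ground by (auto simp: F_def)
  obtain B where B: "finite B" "card B = k" "B \<inter> ?E = {}"
    using exists_disjoint_set_of_card[OF M.finite_ground] .
  have "\<forall>f \<in> F. \<exists>\<sigma>. frame_rep (delete M {f}) B \<sigma>"
    using kf(2) B by (auto simp: F_def)
  then obtain \<sigma> where \<sigma>: "\<And>f. f \<in> F \<Longrightarrow> frame_rep (delete M {f}) B (\<sigma> f)"
    by metis
  have \<sigma>_B: "\<sigma> f x \<subseteq> B" "card (\<sigma> f x) \<le> 2" if "f \<in> F" "x \<in> ?E" "x \<noteq> f" for f x
  proof -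
    have "x \<in> ground (delete M {f})"
      using that by simp
    then show "\<sigma> f x \<subseteq> B" "card (\<sigma> f x) \<le> 2"
      using \<sigma>[OF that(1)] unfolding frame_rep_def by blast+
  qed
  have \<sigma>_bic: "bicircular (\<sigma> f) X" if "f \<in> F" "indep M X" "f \<notin> X" for f X
  proof -
    have "indep (delete M {f}) X"
      using that(3) M.indep_subset_ground[OF that(2)] by (simp add: indep_delete that(2) subset_Diff_insert)
    then show ?thesis
      using \<sigma>[OF that(1)] unfolding frame_rep_def by blast
  qed
  have pair: "indep M {x, y}" if "x \<in> ?E" "y \<in> ?E" for x y
    using indep_pair_excluded_minor[OF M that] .
  have "(2::nat) ^ k \<le> 2 ^ (2 * r)"
    using k(1) by (intro power_increasing) auto
  then have card_Pow_B: "card (Pow B) \<le> 4 ^ r"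
    using B by (simp add: card_Pow power_mult)
  have "0 < card F"
    using k(2) unfolding F_def by (rule le_less_trans[OF le0])
  then obtain g where g: "g \<in> F"
    by (metis card_gt_0_iff ex_in_conv)
  define cls where "cls S = {x \<in> ?E. x \<noteq> g \<and> \<sigma> g x = S}" for S
  define Q where "Q f = (SIGMA S : Pow B. \<Union> (\<sigma> f ` (cls S - {f})))" for f
  have range: "Q ` F \<subseteq> Pow (Pow B \<times> B)"
  proof
    fix R assume "R \<in> Q ` F"
    then obtain f where f: "f \<in> F" "R = Q f"
      by blast
    have "\<Union> (\<sigma> f ` (cls S - {f})) \<subseteq> B" for S
      using \<sigma>_B(1)[OF f(1)] by (auto simp: cls_def)
    then show "R \<in> Pow (Pow B \<times> B)"
      by (auto simp: f(2) Q_def)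
  qed
  have "card (Pow B \<times> B) \<le> 4 ^ r * (2 * r)"
    unfolding card_cartesian_product using card_Pow_B B(2) k(1) by (intro mult_le_mono) auto
  then have "card (Pow (Pow B \<times> B)) \<le> 2 ^ (4 ^ r * (2 * r))"
    unfolding card_Pow[OF finite_cartesian_product, OF finite_Pow_iff[THEN iffD2, OF B(1)] B(1)]
    by (rule power_increasing) simp
  then have "card (Pow (Pow B \<times> B)) * A \<le> 2 ^ (4 ^ r * (2 * r)) * A"
    by (rule mult_le_mono1)
  then have "card (Pow (Pow B \<times> B)) * A < card F"
    using k(2) unfolding F_def by (rule le_less_trans)
  moreover have "finite (Pow (Pow B \<times> B))"
    using B(1) by simp
  ultimately obtain q where q: "A < card {f \<in> F. Q f = q}"
    using pigeonhole_fibre[OF F(2) range] by blast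
  define G where "G = {f \<in> F. Q f = q}"
  have dev: "card {x \<in> ?E. x \<noteq> f \<and> \<sigma> f x \<noteq> q `` {\<sigma> g x}} \<le> c" if "f \<in> G" for f
  proof -
    have f: "f \<in> F" "Q f = q"
      using that by (auto simp: G_def)
    define J where "J = {x \<in> ?E. x \<noteq> f \<and> card (\<sigma> f x) \<le> 1}"
    define R where "R = (\<Union>S\<in>{S \<in> Pow B. card (cls S) \<le> 4}. cls S)"
    \<comment> \<open>The exceptions are \<open>g\<close>, where \<open>\<sigma> g\<close> is
      unconstrained, the small classes, and the elements whose support under
      \<open>\<sigma> f\<close> is not a pair.\<close>
    have "{x \<in> ?E. x \<noteq> f \<and> \<sigma> f x \<noteq> q `` {\<sigma> g x}} \<subseteq> insert g (R \<union> J)"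
    proof (rule ccontr)
      assume "\<not> ?thesis"
      then obtain x where x: "x \<in> ?E" "x \<noteq> f" "\<sigma> f x \<noteq> q `` {\<sigma> g x}" "x \<noteq> g" "x \<notin> R" "x \<notin> J"
        by blast
      let ?S = "\<sigma> g x"
      let ?L = "cls ?S - {f}"
      have S: "?S \<in> Pow B" "card ?S \<le> 2"
        using \<sigma>_B g x by auto
      have "x \<in> ?L"
        using x by (simp add: cls_def)
      have "\<not> card (cls ?S) \<le> 4"
        using x(5) S \<open>x \<in> ?L\<close> by (auto simp: R_def)
      \<comment> \<open>A class of at least five elements keeps four when \<open>f\<close> is
        removed, as the line lemma requires.\<close>
      then have "4 \<le> card ?L"
        using diff_card_le_card_Diff[of "{f}" "cls ?S"] by simp
      \<comment> \<open>Under \<open>\<sigma> g\<close> three elements of one class share at most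
        two vertices, so they are dependent in \<open>M\<close>.\<close>
      moreover have "\<not> indep (delete M {f}) {u, v, w}"
        if "u \<in> ?L" "v \<in> ?L" "w \<in> ?L" "u \<noteq> v" "u \<noteq> w" "v \<noteq> w" for u v w
      proof
        assume "indep (delete M {f}) {u, v, w}"
        then have "bicircular (\<sigma> g) {u, v, w}"
          using that by (intro \<sigma>_bic g) (auto simp: indep_delete cls_def)
        then have "card {u, v, w} \<le> card (\<Union> (\<sigma> g ` {u, v, w}))"
          unfolding bicircular_def by blast
        moreover have "\<Union> (\<sigma> g ` {u, v, w}) = ?S"
          using that by (auto simp: cls_def)
        ultimately show False
          using that S(2) by simp
      qed
      moreover have "indep (delete M {f}) {u, v}" if "u \<in> ?L" "v \<in> ?L" for u v
        using that pair by (auto simp: indep_delete cls_def)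
      moreover have "?L \<subseteq> ground (delete M {f})"
        by (auto simp: cls_def)
      ultimately have "card (\<Union> (\<sigma> f ` ?L)) \<le> 2"
        using card_supports_line_le[OF \<sigma>[OF f(1)] M.matroid_delete] by blast
      moreover have "q `` {?S} = \<Union> (\<sigma> f ` ?L)"
        unfolding f(2)[symmetric] Q_def using S(1) by blast
      moreover have "\<sigma> f x \<subseteq> \<Union> (\<sigma> f ` ?L)"
        using \<open>x \<in> ?L\<close> by blast
      moreover have "\<Union> (\<sigma> f ` ?L) \<subseteq> B"
        using \<sigma>_B(1)[OF f(1)] by (auto simp: cls_def)
      moreover have "2 \<le> card (\<sigma> f x)"
        using x by (auto simp: J_def)
      \<comment> \<open>A support with two elements inside a set of at most two elements is the
        whole set.\<close>
      ultimately have "\<sigma> f x = q `` {?S}"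
        using B(1) by (metis card_seteq finite_subset order_trans)
      then show False
        using x(3) by contradiction
    qed
    moreover have "finite R" "finite J"
      using M.finite_ground by (auto simp: R_def J_def cls_def intro: finite_subset[of _ ?E])
    moreover have "card R \<le> 4 ^ r * 4"
    proof -
      have "card R \<le> (\<Sum>S\<in>{S \<in> Pow B. card (cls S) \<le> 4}. card (cls S))"
        unfolding R_def using B(1) by (intro card_UN_le) simp
      also have "\<dots> \<le> (\<Sum>S\<in>{S \<in> Pow B. card (cls S) \<le> 4}. 4)"
        by (rule sum_mono) simp
      also have "\<dots> \<le> card (Pow B) * 4"
        using B(1) by (auto intro!: card_mono)
      finally show ?thesis
        using card_Pow_B by linarith
    qed
    \<comment> \<open>Elements of \<open>M\<close> are nonloops and pairwise nonparallel, so by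
      bicircularity the supports on \<open>J\<close> are distinct singletons.\<close>
    moreover have "card J \<le> 2 * r"
    proof -
      have "inj_on (\<sigma> f) J"
      proof (rule inj_onI, rule ccontr)
        fix x y assume xy: "x \<in> J" "y \<in> J" "\<sigma> f x = \<sigma> f y" "x \<noteq> y"
        then have "bicircular (\<sigma> f) {x, y}"
          using f pair by (intro \<sigma>_bic) (auto simp: J_def)
        then have "card {x, y} \<le> card (\<Union> (\<sigma> f ` {x, y}))"
          unfolding bicircular_def by blast
        then show False
          using xy by (simp add: J_def)
      qed
      moreover have "\<sigma> f ` J \<subseteq> (\<lambda>b. {b}) ` B"
      proof
        fix S assume "S \<in> \<sigma> f ` J"
        then obtain x where x: "x \<in> J" "S = \<sigma> f x"
          by blast
        then have "bicircular (\<sigma> f) {x}"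
          using f pair[of x x] by (intro \<sigma>_bic) (auto simp: J_def)
        then have "card {x} \<le> card (\<Union> (\<sigma> f ` {x}))"
          unfolding bicircular_def by blast
        then have "card S = 1"
          using x by (simp add: J_def)
        moreover have "S \<subseteq> B"
          using x \<sigma>_B(1)[OF f(1)] by (auto simp: J_def)
        ultimately show "S \<in> (\<lambda>b. {b}) ` B"
          by (auto simp: card_1_singleton_iff)
      qed
      ultimately have "card J \<le> card ((\<lambda>b. {b}) ` B)"
        using B(1) by (intro card_inj_on_le) auto
      also have "\<dots> \<le> card B"
        using B(1) by (rule card_image_le)
      finally show ?thesis
        using B(2) k(1) by simp
    qed
    ultimately have "card {x \<in> ?E. x \<noteq> f \<and> \<sigma> f x \<noteq> q `` {\<sigma> g x}} \<le> card (insert g (R \<union> J))"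
      by (intro card_mono) auto
    also have "\<dots> \<le> Suc (card (R \<union> J))"
      by (rule card_insert_le_m1) simp_all
    also have "\<dots> \<le> Suc (card R + card J)"
      using card_Un_le by auto
    also have "\<dots> \<le> c"
      using \<open>card R \<le> 4 ^ r * 4\<close> \<open>card J \<le> 2 * r\<close> by (simp add: c_def)
    finally show ?thesis .
  qed
  have "\<exists>\<tau>. \<forall>Y \<subseteq> ?E. card Y \<le> 2 * r + 1 \<longrightarrow> (\<exists>f \<in> G. f \<notin> Y \<and> (\<forall>x \<in> Y. \<sigma> f x = \<tau> x))"
  proof (rule locally_agreeing_pattern[of G "2 * r + 1" "4 ^ r" c "Pow B" ?E \<sigma> "\<lambda>x. q `` {\<sigma> g x}"])
    show "agree_bound (2 * r + 1) (4 ^ r) c \<le> card G"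
      using q by (simp add: A_def G_def)
  qed (use F B card_Pow_B \<sigma>_B dev M.finite_ground in \<open>auto simp: G_def\<close>)
  then obtain \<tau> where "\<And>Y. Y \<subseteq> ?E \<Longrightarrow> card Y \<le> 2 * rank M + 1 \<Longrightarrow> \<exists>f \<in> G. f \<notin> Y \<and> (\<forall>x \<in> Y. \<sigma> f x = \<tau> x)"
    by (auto simp: r_def)
  then have "frame_matroid M"
    using \<sigma> B by (intro frame_matroid_if_locally_rep[of M B G \<sigma> \<tau>] M.matroid_axioms) (auto simp: G_def)
  then show False
    using M by (simp add: excluded_minor_def)
qed

section \<open>Finitely many matroids of bounded size\<close>

lemma finite_matroids_on:
  assumes "finite W"
  shows "finite {M. matroid M \<and> ground M \<subseteq> W}"
proof -
  have "{M. matroid M \<and> ground M \<subseteq> W}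
    \<subseteq> (\<lambda>(E, \<I>). \<lparr>ground = E, indep = (\<lambda>X. X \<in> \<I>)\<rparr>) ` (Pow W \<times> Pow (Pow W))"
  proof
    fix M assume "M \<in> {M. matroid M \<and> ground M \<subseteq> W}"
    then have "matroid M" "ground M \<subseteq> W"
      by auto
    then have "Collect (indep M) \<subseteq> Pow W"
      using matroid.indep_subset_ground by blast
    then show "M \<in> (\<lambda>(E, \<I>). \<lparr>ground = E, indep = (\<lambda>X. X \<in> \<I>)\<rparr>) ` (Pow W \<times> Pow (Pow W))"
      using \<open>ground M \<subseteq> W\<close>
      by (intro image_eqI[of _ _ "(ground M, Collect (indep M))"]) auto
  qed
  then show ?thesis
    by (rule finite_subset) (use assms in simp)
qed

lemma isomorphic_pull:
  assumes "bij_betw \<phi> D (ground M)"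
  shows "isomorphic (pull M \<phi> D) M"
proof -
  have "inj_on \<phi> X" if "X \<subseteq> D" for X
    using assms that by (meson bij_betw_def inj_on_subset)
  then show ?thesis
    unfolding isomorphic_def using assms by (intro exI[of _ \<phi>]) (auto simp: indep_pull)
qed

text \<open>Pulling back along a bijection moves each matroid into one fixed set \<open>W\<close> of
  \<open>n\<close> elements, on which there are finitely many matroids.\<close>

lemma finite_iso_classes_of_bounded_size:
  assumes "\<And>M. M \<in> \<C> \<Longrightarrow> matroid M \<and> card (ground M) \<le> n"
  shows "finite (\<C> // (iso_rel :: ('a::infinite matroid \<times> 'a matroid) set))"
proof -
  obtain W :: "'a set" where W: "finite W" "card W = n"
    using exists_disjoint_set_of_card[of "{}"] by auto
  have "\<C> // iso_rel \<subseteq> (\<lambda>M. iso_rel `` {M}) ` {M. matroid M \<and> ground M \<subseteq> W}"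
  proof
    fix K assume "K \<in> \<C> // iso_rel"
    then obtain M where M: "M \<in> \<C>" "K = iso_rel `` {M}"
      by (rule quotientE)
    then interpret matroid M
      using assms by blast
    obtain D where D: "D \<subseteq> W" "card D = card (ground M)"
      using obtain_subset_with_card_n[of "card (ground M)" W] assms[OF M(1)] W(2) by blast
    then have "finite D"
      using W(1) finite_subset by blast
    then obtain \<phi> where \<phi>: "bij_betw \<phi> D (ground M)"
      using finite_same_card_bij[OF _ finite_ground D(2)] by blast
    have P: "matroid (pull M \<phi> D)"
      using matroid_axioms \<open>finite D\<close> by (rule matroid_pull)
    then have "(pull M \<phi> D, M) \<in> iso_rel"
      using isomorphic_pull[OF \<phi>] matroid_axioms by (simp add: iso_rel_def)
    then have "K = iso_rel `` {pull M \<phi> D}"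
      using equiv_class_eq[OF equiv_iso_rel] M(2) by metis
    then show "K \<in> (\<lambda>M. iso_rel `` {M}) ` {M. matroid M \<and> ground M \<subseteq> W}"
      using P D(1) by auto
  qed
  then show ?thesis
    using finite_matroids_on[OF W(1)] by (meson finite_imageI finite_subset)
qed

theorem theorem1:
  fixes r :: nat
  assumes "r > 0"
  shows "finite ({M :: 'a::infinite matroid.
           excluded_minor {M. frame_matroid M} M \<and> rank M = r} // iso_rel)"
proof (rule finite_iso_classes_of_bounded_size[where n = "size_bound r"])
  fix M :: "'a matroid"
  assume "M \<in> {M. excluded_minor {M. frame_matroid M} M \<and> rank M = r}"
  then show "matroid M \<and> card (ground M) \<le> size_bound r"
    using card_ground_excluded_minor_le[of M] by (auto simp: excluded_minor_def)
qed

end
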